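(* There exists a normal binary sequence $S$ such that (1) $R_{\mathrm{PPM}^*}(S)=0$, and (2) $\rho_{\mathrm{LZ}}(S)=1$. Here $R_T(S)=\limsup_{m\to\infty}|T(S\upharpoonright m)|/m$ and $\rho_T(S)=\liminf_{m\to\infty}|T(S\upharpoonright m)|/m$.
   Context: $S\upharpoonright m$ is the length-$m$ prefix of $S$; $\log$ is base $2$. A binary sequence $S$ is normal if for every $w\in\{0,1\}^*$, $\lim_{n\to\infty}\mathrm{occ}(w,S\upharpoonright n)/n=2^{-|w|}$, where $\mathrm{occ}(w,x)$ is the number of occurrences of $w$ as a substring of $x$. $\mathrm{LZ}$ is the Lempel-Ziv 78 compressor: it parses $x=x_1x_2\cdots x_n$ into phrases, each new phrase being the shortest prefix of the remaining input that is not an earlier phrase (the last phrase may repeat), so each $x_i=x_{l(i)}b_i$ with $l(i)<i$, $x_0=\lambda$, $b_i$ a bit; it outputs $c_{l(1)}b_1c_{l(2)}b_2\cdots c_{l(n)}b_n$ where $c_j$ is a prefix-free encoding of the pointer $j$. The $\mathrm{PPM}^*$ compressor (without exclusion, escape Method C) on binary input: after reading a prefix $x$, each stored context $c$ has, for each bit $b$, a frequency count equal to the number of occurrences of $cb$ in $x$, and an escape count equal to the number of distinct bits that have followed $c$ in $x$; deterministic means escape count $1$. The stored contexts are the empty context and, whenever a string $w$ occurs at least twice in $x$, the contexts $wb$ for each bit $b$ such that $wb$ occurs in $x$ followed by a further bit. Relevant contexts are stored contexts that are suffixes of $x$; the current context is the shortest deterministic relevant one, or the longest relevant one if none is deterministic.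 If the next bit $b$ has count $f>0$ in the current context it is encoded with probability $f/(T+e)$ ($T$ total bit count, $e$ escape count); otherwise an escape is encoded with probability $e/(T+e)$ and the next shorter relevant context becomes current; if $b$ is unseen even in the empty context, after the escape it is encoded with probability $1/2$. The model is then updated. The output is an arithmetic code of length $\lceil -\log P\rceil+O(1)$, $P$ the product of all probabilities used. *)

theory Defs
  imports Complex_Main "HOL-Library.Extended_Real" "HOL-Library.Liminf_Limsup"
begin

definition prefix_of :: "(nat \<Rightarrow> bool) \<Rightarrow> nat \<Rightarrow> bool list" where
  "prefix_of S m = map S [0..<m]"

definition occ :: "bool list \<Rightarrow> bool list \<Rightarrow> nat" where
  "occ w x = card {i. i + length w \<le> length x \<and> take (length w) (drop i x) = w}"

definition normal :: "(nat \<Rightarrow> bool) \<Rightarrow> bool" where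
  "normal S \<longleftrightarrow> (\<forall>w. (\<lambda>n. real (occ w (prefix_of S n)) / real n) \<longlonglongrightarrow> 1 / 2 ^ length w)"

fun bin :: "nat \<Rightarrow> bool list" where
  "bin n = (if n \<le> 1 then [True] else bin (n div 2) @ [odd n])"

definition elias_gamma :: "nat \<Rightarrow> bool list" where
  "elias_gamma n = replicate (length (bin n) - 1) False @ bin n"

definition elias_delta :: "nat \<Rightarrow> bool list" where
  "elias_delta n = elias_gamma (length (bin n)) @ tl (bin n)"

definition ptr_code :: "nat \<Rightarrow> bool list" where
  "ptr_code j = elias_delta (j + 1)"

text \<open>Length of the next phrase: shortest nonempty prefix of w not in the dictionary D,
  or all of w if every prefix is already a phrase (last phrase may repeat).\<close>
definition next_len :: "bool list list \<Rightarrow> bool list \<Rightarrow> nat" where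
  "next_len D w = (if \<exists>k. 1 \<le> k \<and> k \<le> length w \<and> take k w \<notin> set D
     then (LEAST k. 1 \<le> k \<and> k \<le> length w \<and> take k w \<notin> set D) else length w)"

lemma next_len_pos: "w \<noteq> [] \<Longrightarrow> 1 \<le> next_len D w"
proof -
  assume "w \<noteq> []"
  show ?thesis
  proof (cases "\<exists>k. 1 \<le> k \<and> k \<le> length w \<and> take k w \<notin> set D")
    case True
    then have "1 \<le> (LEAST k. 1 \<le> k \<and> k \<le> length w \<and> take k w \<notin> set D)"
      by (rule LeastI2_ex) auto
    then show ?thesis using True unfolding next_len_def by presburger
  next
    case False
      then have "next_len D w = length w" unfolding next_len_def by (simp only: if_False)
    then show ?thesis using \<open>w \<noteq> []\<close> by (simp add: Suc_leI)
  qed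
qed

definition ptr :: "bool list list \<Rightarrow> bool list \<Rightarrow> nat" where
  "ptr D p = (if p = [] then 0 else Suc (LEAST i. i < length D \<and> D ! i = p))"

function lz_parse :: "bool list list \<Rightarrow> bool list \<Rightarrow> (nat \<times> bool) list" where
  "lz_parse D w = (if w = [] then [] else
     (let p = take (next_len D w) w
      in (ptr D (butlast p), last p) # lz_parse (D @ [p]) (drop (next_len D w) w)))"
  by pat_completeness auto
termination
  by (relation "measure (\<lambda>(D, w). length w)") (auto, metis diff_less next_len_pos length_greater_0_conv less_le_trans zero_less_one)

definition LZ :: "bool list \<Rightarrow> bool list" where
  "LZ x = concat (map (\<lambda>(l, b). ptr_code l @ [b]) (lz_parse [] x))"

section \<open>PPM* (without exclusion, escape method C)\<close>

definition cnt :: "bool list \<Rightarrow> bool list \<Rightarrow> bool \<Rightarrow> nat" where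
  "cnt x c b = occ (c @ [b]) x"

definition esc :: "bool list \<Rightarrow> bool list \<Rightarrow> nat" where
  "esc x c = card {b. 0 < occ (c @ [b]) x}"

definition stored :: "bool list \<Rightarrow> bool list \<Rightarrow> bool" where
  "stored x c \<longleftrightarrow> c = [] \<or> (2 \<le> occ (butlast c) x \<and> (\<exists>b'. 0 < occ (c @ [b']) x))"

definition deterministic :: "bool list \<Rightarrow> bool list \<Rightarrow> bool" where
  "deterministic x c \<longleftrightarrow> esc x c = 1"

definition relevant :: "bool list \<Rightarrow> bool list list" where
  "relevant x = filter (stored x) (map (\<lambda>i. drop i x) [0..<Suc (length x)])"

text \<open>The current context followed by the shorter relevant contexts.\<close>
definition ctx_chain :: "bool list \<Rightarrow> bool list list" where
  "ctx_chain x = (if \<exists>c\<in>set (relevant x). deterministic x c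
     then dropWhile (\<lambda>c. c \<noteq> last (filter (deterministic x) (relevant x))) (relevant x)
     else relevant x)"

text \<open>Probability with which bit b is encoded, walking down the chain of contexts.
  Convention: a context with total count 0 and escape count 0 (only the empty context
  before any input) escapes with probability 1.\<close>
fun code_prob :: "bool list \<Rightarrow> bool \<Rightarrow> bool list list \<Rightarrow> real" where
  "code_prob x b [] = 1 / 2"
| "code_prob x b (c # cs) =
     (let f = cnt x c b; T = cnt x c False + cnt x c True; e = esc x c in
      if 0 < f then real f / real (T + e)
      else (if T + e = 0 then 1 else real e / real (T + e)) * code_prob x b cs)"

definition ppm_prob :: "bool list \<Rightarrow> real" where
  "ppm_prob x = (\<Prod>i<length x. code_prob (take i x) (x ! i) (ctx_chain (take i x)))"

text \<open>Length of the PPM* output (arithmetic code; the additive O(1) is dropped).\<close>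
definition ppm_len :: "bool list \<Rightarrow> nat" where
  "ppm_len x = nat \<lceil>- log 2 (ppm_prob x)\<rceil>"

end

theory Submission
  imports Defs "Graph_Theory.Euler" "HOL-Real_Asymp.Real_Asymp" "HOL-Number_Theory.Cong"
begin

text \<open>
  The sequence is that of Pierce and Shields: block \<open>n\<close> consists of \<open>n\<close> rotations of a de Bruijn
  word of order \<open>n\<close>, the rotation advancing by one after every \<open>lcm n (2 ^ n)\<close> bits. Cut into words
  of length \<open>n\<close>, block \<open>n\<close> lists every word of length \<open>n\<close> exactly once, so LZ78 parses the whole
  sequence into all words ordered by length, and a phrase of length \<open>n\<close> costs at least \<open>n\<close> bits.
  Normality is inherited from the de Bruijn words.

  For PPM*, every bit of block \<open>n\<close> costs only \<open>O(log n)\<close>: all words of length \<open>n - 2\<close> have been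
  seen with both continuations, and they have occurred polynomially often. In the rotation with index
  \<open>\<rho> \<ge> 2\<close> a bit costs at most \<open>log 2 ((\<rho> + 1) / \<rho>)\<close>, unless the preceding \<open>2 n\<close> bits have
  occurred with the other continuation. Such a conflict is either at the seam of two rotations, which
  is rare, or ends a common factor of length at least \<open>2 n\<close> of the de Bruijn words of orders \<open>n\<close> and
  \<open>k < n\<close>. That factor contains \<open>n + 1\<close> windows of length \<open>n\<close>, and distinct conflicts have disjoint
  sets of windows, so there are at most \<open>2 ^ k / (n + 1)\<close> of them. Altogether block \<open>n\<close>, which has
  \<open>n 2 ^ n\<close> bits, is encoded in \<open>O(2 ^ n log n)\<close> bits.
\<close>

section \<open>De Bruijn sequences\<close>

definition factor :: "(nat \<Rightarrow> 'a) \<Rightarrow> nat \<Rightarrow> nat \<Rightarrow> 'a list" where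
  "factor f i l = map f [i..<i + l]"

lemma length_factor [simp]: "length (factor f i l) = l"
  by (simp add: factor_def)

lemma nth_factor [simp]: "j < l \<Longrightarrow> factor f i l ! j = f (i + j)"
  by (simp add: factor_def)

lemma factor_eq_iff: "factor f i l = factor g k l \<longleftrightarrow> (\<forall>j<l. f (i + j) = g (k + j))"
  by (auto simp: list_eq_iff_nth_eq)

text \<open>A periodic function replaces the finite cyclic word, so rotating is shifting the
  argument and no window wraps around. By counting, distinctness of the \<open>2 ^ n\<close> windows
  makes every word of length \<open>n\<close> appear.\<close>

definition de_bruijn :: "nat \<Rightarrow> (nat \<Rightarrow> bool) \<Rightarrow> bool" where
  "de_bruijn n f \<longleftrightarrow> (\<forall>i. f (i + 2 ^ n) = f i) \<and> inj_on (\<lambda>i. factor f i n) {..<2 ^ n}"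

lemma finite_words: "finite {w :: bool list. length w = n}"
  using finite_lists_length_eq[of "UNIV :: bool set" n] by simp

lemma card_words: "card {w :: bool list. length w = n} = 2 ^ n"
  using card_lists_length_eq[of "UNIV :: bool set" n] by simp

text \<open>The de Bruijn graph: an Eulerian circuit in it passes through every word of length
  \<open>Suc n\<close> exactly once.\<close>

definition word_graph :: "nat \<Rightarrow> (bool list, bool list) pre_digraph" where
  "word_graph n = \<lparr>verts = {w. length w = n}, arcs = {w. length w = Suc n}, tail = butlast, head = tl\<rparr>"

lemma word_graph_simps [simp]:
  "verts (word_graph n) = {w. length w = n}" "arcs (word_graph n) = {w. length w = Suc n}"
  "tail (word_graph n) = butlast" "head (word_graph n) = tl"
  by (simp_all add: word_graph_def)

lemma fin_digraph_word_graph: "fin_digraph (word_graph n)"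
  by unfold_locales (auto simp: finite_words)

text \<open>The letters of \<open>v\<close> are shifted in from the right one at a time;
  \<open>k = n\<close> reaches \<open>v\<close> itself and yields connectedness.\<close>

lemma word_graph_shift:
  assumes "length v = n" "k \<le> n" "length u = n"
  shows "u \<rightarrow>\<^sup>*\<^bsub>word_graph n\<^esub> (drop k u @ take k v)"
  using assms(2)
proof (induction k)
  interpret fin_digraph "word_graph n" by (rule fin_digraph_word_graph)
  {
    case 0 then show ?case using assms by (simp add: reachable_refl)
  next
    case (Suc k)
  let ?e = "drop k u @ take (Suc k) v"
  have "length ?e = Suc n" using Suc assms by simp
  moreover have "butlast ?e = drop k u @ take k v"
    using Suc assms by (simp add: butlast_append take_Suc_conv_app_nth)
  moreover have "tl ?e = drop (Suc k) u @ take (Suc k) v"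
    using Suc assms by (metis (no_types, lifting) Cons_nth_drop_Suc Suc_le_lessD append_Cons list.sel(3))
  ultimately have "(drop k u @ take k v, drop (Suc k) u @ take (Suc k) v) \<in> arcs_ends (word_graph n)"
    unfolding arcs_ends_def arc_to_ends_def by (auto simp: image_iff intro!: exI[of _ ?e])
  then show ?case using Suc by (meson Suc_leD reachable_adj_trans)
  }
qed

lemma connected_word_graph: "connected (word_graph n)"
proof -
  interpret fin_digraph "word_graph n" by (rule fin_digraph_word_graph)
  have "u \<rightarrow>\<^sup>*\<^bsub>mk_symmetric (word_graph n)\<^esub> v" if "length u = n" "length v = n" for u v
    using word_graph_shift[of v n n u] that by (simp add: reachable_mk_symmetricI)
  then show ?thesis
    by (intro connectedI) (auto intro: exI[of _ "replicate n True"])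
qed

text \<open>Two arcs enter, by prepending a letter, and two leave, by appending one. Euler's theorem
  asks for this balance.\<close>

lemma word_graph_degrees:
  assumes "length u = n"
  shows "in_degree (word_graph n) u = out_degree (word_graph n) u"
proof -
  have "w \<in> in_arcs (word_graph n) u \<longleftrightarrow> w \<in> (\<lambda>b. b # u) ` UNIV" for w
    using assms by (cases w) (auto simp: in_arcs_def)
  then have "in_arcs (word_graph n) u = (\<lambda>b. b # u) ` UNIV" by blast
  moreover have "w \<in> out_arcs (word_graph n) u \<longleftrightarrow> w \<in> (\<lambda>b. u @ [b]) ` UNIV" for w
    using assms by (cases w rule: rev_cases) (auto simp: out_arcs_def)
  then have "out_arcs (word_graph n) u = (\<lambda>b. u @ [b]) ` UNIV" by blast
  ultimately show ?thesis
    unfolding in_degree_def out_degree_def by (simp add: card_image inj_on_def)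
qed

lemma (in pre_digraph) cas_nth:
  assumes "cas u p v" "Suc i < length p"
  shows "head G (p ! i) = tail G (p ! Suc i)"
  using assms
proof (induction p arbitrary: u i)
  case (Cons e p)
  then show ?case by (cases i; cases p) auto
qed simp

lemma (in pre_digraph) cas_hd_last:
  assumes "cas u p v" "p \<noteq> []"
  shows "tail G (p ! 0) = u" "head G (p ! (length p - 1)) = v"
  using assms by (induction p arbitrary: u) (auto simp: nth_Cons' gr0_conv_Suc)

text \<open>An Eulerian circuit on words of length \<open>n - 1\<close> lists the words of length
  \<open>n\<close> as arcs, consecutive ones overlapping in \<open>n - 1\<close> letters. Their
  first letters form the cyclic word.\<close>

lemma ex_de_bruijn: "\<exists>f. de_bruijn n f"
proof (cases n)
  case 0
  then show ?thesis by (intro exI[of _ "\<lambda>_. False"]) (simp add: de_bruijn_def inj_on_def)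
next
  case n: (Suc m)
  interpret fin_digraph "word_graph m" by (rule fin_digraph_word_graph)
  obtain u p where "euler_trail u p u"
    using closed_euler1[OF connected_word_graph] word_graph_degrees by auto
  then have dist: "distinct p" and cas: "cas u p u" and set: "set p = {w. length w = n}"
    by (auto simp: euler_trail_def trail_def awalk_def n)
  have len: "length p = 2 ^ n"
    using distinct_card[OF dist] card_words[of n] set by simp
  define q where "q i = p ! (i mod 2 ^ n)" for i
  have qlen: "length (q i) = n" for i
    using set nth_mem[of "i mod 2 ^ n" p] by (auto simp: q_def len)
  have step: "tl (q i) = butlast (q (Suc i))" for i
  proof (cases "Suc (i mod 2 ^ n) = 2 ^ n")
    \<comment> \<open>The step from the last arc back to the first: here the circuit has to be
      closed.\<close>
    case True
    then have *: "i mod 2 ^ n = length p - 1" and "p \<noteq> []" using len by auto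
    then show ?thesis using cas_hd_last[OF cas] True by (simp add: q_def mod_Suc)
  next
    case False
    then have "Suc (i mod 2 ^ n) < length p"
      unfolding len by (metis Suc_lessI mod_less_divisor zero_less_numeral zero_less_power)
    then show ?thesis using cas_nth[OF cas, of "i mod 2 ^ n"] False by (simp add: q_def mod_Suc)
  qed
  define f where "f i = hd (q i)" for i
  \<comment> \<open>By the overlaps, the letter at index \<open>j\<close> of arc \<open>i\<close>
    moves one place to the left with each arc, and is the first letter of arc
    \<open>i + j\<close>.\<close>
  have nth: "q i ! j = f (i + j)" if "j < n" for i j
    using that
  proof (induction j arbitrary: i)
    case 0
    then have "q i \<noteq> []" using qlen[of i] by auto
    then show ?case by (simp add: f_def hd_conv_nth)
  next
    case (Suc j)
    then have "q i ! Suc j = tl (q i) ! j" using qlen[of i] by (simp add: nth_tl)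
    also have "\<dots> = q (Suc i) ! j" using Suc.prems qlen[of "Suc i"] by (simp add: step nth_butlast)
    finally show ?case using Suc by simp
  qed
  have fac: "factor f i n = q i" for i
    by (rule nth_equalityI) (simp_all add: qlen nth)
  have "de_bruijn n f"
    unfolding de_bruijn_def fac
    using dist by (auto simp: f_def q_def inj_on_def len nth_eq_iff_index_eq)
  then show ?thesis by blast
qed

section \<open>The sequence\<close>

definition db :: "nat \<Rightarrow> nat \<Rightarrow> bool" where
  "db n = (SOME f. de_bruijn n f)"

lemma de_bruijn_db: "de_bruijn n (db n)"
  unfolding db_def using ex_de_bruijn by (rule someI_ex)

lemma db_add_mult: "db n (i + k * 2 ^ n) = db n i"
proof (induction k)
  case (Suc k)
  have "db n (i + k * 2 ^ n + 2 ^ n) = db n (i + k * 2 ^ n)"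
    using de_bruijn_db[of n] by (simp only: de_bruijn_def)
  then show ?case using Suc by (simp add: ac_simps)
qed simp

lemma db_mod [simp]: "db n (i mod 2 ^ n) = db n i"
  using db_add_mult[of n "i mod 2 ^ n" "i div 2 ^ n"] by (simp only: mod_div_mult_eq)

lemma db_cong: "i mod 2 ^ n = j mod 2 ^ n \<Longrightarrow> db n i = db n j"
  by (metis db_mod)

lemma db_add_cong: "i mod 2 ^ n = j mod 2 ^ n \<Longrightarrow> db n (i + x) = db n (j + x)"
  by (rule db_cong) (rule mod_add_cong, auto)

text \<open>A window of \<open>n\<close> letters determines the phase, and thereby all letters that
  follow it.\<close>

lemma factor_db_eq_iff: "factor (db n) i n = factor (db n) j n \<longleftrightarrow> i mod 2 ^ n = j mod 2 ^ n"
proof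
  assume eq: "factor (db n) i n = factor (db n) j n"
  have "factor (db n) (i mod 2 ^ n) n = factor (db n) i n" for i
    unfolding factor_eq_iff by (intro allI impI db_add_cong) simp
  then show "i mod 2 ^ n = j mod 2 ^ n"
    using de_bruijn_db[of n] eq by (auto simp: de_bruijn_def inj_on_def)
next
  assume "i mod 2 ^ n = j mod 2 ^ n"
  then show "factor (db n) i n = factor (db n) j n"
    unfolding factor_eq_iff by (intro allI impI db_add_cong)
qed

section \<open>Block boundaries, positions in a block, and averages over blocks\<close>

definition start :: "nat \<Rightarrow> nat" where
  "start n = (\<Sum>k<n. k * 2 ^ k)"

lemma start_Suc [simp]: "start (Suc n) = start n + n * 2 ^ n"
  by (simp add: start_def)

lemma start_0 [simp]: "start 0 = 0"
  by (simp add: start_def)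

lemma mono_start: "m \<le> n \<Longrightarrow> start m \<le> start n"
  unfolding start_def by (rule sum_mono2) auto

lemma real_start: "real (start n) = (real n - 2) * 2 ^ n + 2"
  by (induction n) (auto simp: algebra_simps)

lemma le_start: "n \<le> start (Suc n)"
  by (simp add: trans_le_add2)

definition level :: "nat \<Rightarrow> nat" where
  "level t = (LEAST n. t < start (Suc n))"

lemma level_less: "t < start (Suc (level t))"
  unfolding level_def
proof (rule LeastI_ex)
  have "t < start (Suc (Suc t))" using le_start[of "Suc t"] by linarith
  then show "\<exists>n. t < start (Suc n)" by blast
qed

lemma start_level_le: "start (level t) \<le> t"
proof (cases "level t")
  case (Suc k)
  then have "\<not> t < start (Suc k)" unfolding level_def by (metis lessI not_less_Least)
  then show ?thesis by (simp add: Suc)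
qed simp

lemma level_eqI:
  assumes "start n \<le> t" "t < start (Suc n)"
  shows "level t = n"
proof (rule antisym)
  show "level t \<le> n" unfolding level_def by (rule Least_le) fact
  show "n \<le> level t"
  proof (rule ccontr)
    assume "\<not> n \<le> level t"
    then have "start (Suc (level t)) \<le> start n" by (intro mono_start) simp
    then show False using level_less[of t] assms by simp
  qed
qed

text \<open>Multiples of \<open>n\<close> return to \<open>0\<close> modulo \<open>2 ^ n\<close>
  after \<open>lcm n (2 ^ n)\<close> bits, so without the quotient in the argument the rest of the
  block would repeat the same words. The quotient moves on to the next residue class modulo
  \<open>gcd n (2 ^ n)\<close>.\<close>

definition seq :: "nat \<Rightarrow> bool" where
  "seq t = (let n = level t; j = t - start n in db n (j + j div lcm n (2 ^ n)))"

lemma seq_start_add: "j < n * 2 ^ n \<Longrightarrow> seq (start n + j) = db n (j + j div lcm n (2 ^ n))"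
  using level_eqI[of n "start n + j"] by (simp add: seq_def Let_def)

text \<open>
  \<open>pos n \<rho> i\<close> is the position of the bit at offset \<open>i < 2 ^ n\<close> in the rotation with index
  \<open>\<rho> < n\<close> of block \<open>n\<close>, and \<open>rot n \<rho>\<close> is the amount by which that copy is rotated.
\<close>

definition pos :: "nat \<Rightarrow> nat \<Rightarrow> nat \<Rightarrow> nat" where
  "pos n \<rho> i = start n + \<rho> * 2 ^ n + i"

definition rot :: "nat \<Rightarrow> nat \<Rightarrow> nat" where
  "rot n \<rho> = \<rho> * 2 ^ n div lcm n (2 ^ n)"

lemma rot_mono: "\<rho>' \<le> \<rho> \<Longrightarrow> rot n \<rho>' \<le> rot n \<rho>"
  unfolding rot_def by (intro div_le_mono) simp

lemma rot_le: "0 < n \<Longrightarrow> rot n \<rho> \<le> \<rho>"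
proof -
  assume "0 < n"
  then have "2 ^ n \<le> lcm n (2 ^ n)" by (intro dvd_imp_le) (auto simp: lcm_pos_nat)
  then have "\<rho> * 2 ^ n div lcm n (2 ^ n) \<le> \<rho> * 2 ^ n div 2 ^ n" by (intro div_le_mono2) auto
  then show ?thesis by (simp add: rot_def)
qed

text \<open>As \<open>b\<close> divides \<open>l\<close>, no multiple of \<open>l\<close> lies
  strictly between \<open>a * b\<close> and \<open>a * b + b\<close>. With \<open>l\<close> the lcm,
  the shift is thus constant on each rotation (\<open>b = 2 ^ n\<close>) and on each word
  (\<open>b = n\<close>).\<close>

lemma div_mult_dvd_add:
  fixes a b i :: nat
  assumes "b dvd l" "i < b"
  shows "(a * b + i) div l = a * b div l"
proof -
  obtain c where "l = b * c" using assms by blast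
  then show ?thesis using assms by (simp add: div_mult2_eq)
qed

lemma piece_less: "\<rho> < n \<Longrightarrow> i < 2 ^ n \<Longrightarrow> \<rho> * 2 ^ n + i < n * (2::nat) ^ n"
proof -
  assume "\<rho> < n" "i < 2 ^ n"
  then have "\<rho> * 2 ^ n + i < Suc \<rho> * 2 ^ n" "Suc \<rho> * 2 ^ n \<le> n * (2::nat) ^ n"
    by (auto simp del: mult_Suc intro!: mult_right_mono) auto
  then show ?thesis by linarith
qed

lemma pos_less_start: "\<rho> < n \<Longrightarrow> i < 2 ^ n \<Longrightarrow> pos n \<rho> i < start (Suc n)"
  using piece_less[of \<rho> n i] by (simp add: pos_def)

lemma seq_pos:
  assumes "\<rho> < n" "i < 2 ^ n"
  shows "seq (pos n \<rho> i) = db n (i + rot n \<rho>)"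
proof -
  have "seq (pos n \<rho> i) = db n (\<rho> * 2 ^ n + i + (\<rho> * 2 ^ n + i) div lcm n (2 ^ n))"
    using seq_start_add[OF piece_less[OF assms]] by (simp add: pos_def add.assoc)
  also have "(\<rho> * 2 ^ n + i) div lcm n (2 ^ n) = rot n \<rho>"
    unfolding rot_def using assms by (intro div_mult_dvd_add) auto
  also have "db n (\<rho> * 2 ^ n + i + rot n \<rho>) = db n (i + rot n \<rho>)"
    using db_add_mult[of n "i + rot n \<rho>" \<rho>] by (simp add: ac_simps)
  finally show ?thesis .
qed

lemma sum_lessThan_add: "(\<Sum>t<a + b. f t) = (\<Sum>t<a. f t) + (\<Sum>t<(b::nat). f (a + t) :: 'a :: comm_monoid_add)"
  by (induction b) (auto simp: ac_simps)

lemma sum_lessThan_mult: "(\<Sum>t<a * b. f t) = (\<Sum>r<a. \<Sum>t<(b::nat). f (r * b + t) :: 'a :: comm_monoid_add)"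
  by (induction a) (auto simp: sum_lessThan_add add.commute[of b])

lemma sum_start: "(\<Sum>t<start n. f t) = (\<Sum>k<n. \<Sum>\<rho><k. \<Sum>i<2 ^ k. f (pos k \<rho> i) :: 'a :: comm_monoid_add)"
  by (induction n) (auto simp: sum_lessThan_add sum_lessThan_mult pos_def add.assoc)

lemma card_start:
  "card {t. t < start n \<and> P t} = (\<Sum>k<n. \<Sum>\<rho><k. card {i. i < 2 ^ k \<and> P (pos k \<rho> i)})"
proof -
  have "card {t. t < m \<and> Q t} = (\<Sum>t<m. if Q t then 1 else 0)" for m :: nat and Q
    by (simp add: Collect_conj_eq lessThan_def flip: sum.inter_filter)
  then show ?thesis by (simp add: sum_start)
qed

lemma card_start_le:
  assumes "\<And>k \<rho>. k < n \<Longrightarrow> \<rho> < k \<Longrightarrow> card {i. i < 2 ^ k \<and> P (pos k \<rho> i)} \<le> B"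
  shows "card {t. t < start n \<and> P t} \<le> n * n * B"
proof -
  have "card {t. t < start n \<and> P t} \<le> (\<Sum>k<n. \<Sum>\<rho><k. B)"
    unfolding card_start using assms by (intro sum_mono) auto
  also have "\<dots> \<le> (\<Sum>k<n. n * B)" by (intro sum_mono) auto
  finally show ?thesis by simp
qed

lemma filterlim_level: "filterlim level at_top sequentially"
  unfolding filterlim_at_top eventually_sequentially
proof (intro allI exI impI)
  fix N t assume "start N \<le> t"
  show "N \<le> level t"
  proof (rule ccontr)
    assume "\<not> N \<le> level t"
    then have "start (Suc (level t)) \<le> start N" by (intro mono_start) simp
    then show False using level_less[of t] \<open>start N \<le> t\<close> by simp
  qed
qed

lemma start_pos: "1 < n \<Longrightarrow> 0 < start n"
  using mono_start[of 2 n] by (simp add: numeral_2_eq_2)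

text \<open>A bound \<open>G n\<close> valid on all of block \<open>n\<close> may be divided by
  \<open>start n\<close>, since \<open>start n \<le> m\<close>. This turns limits over prefixes into
  limits over block indices.\<close>

lemma average_tendsto_zero:
  assumes nonneg: "\<And>m. 0 \<le> F m"
    and le: "\<And>n m. start n \<le> m \<Longrightarrow> m < start (Suc n) \<Longrightarrow> F m \<le> G n"
    and lim: "(\<lambda>n. G n / real (start n)) \<longlonglongrightarrow> 0"
  shows "(\<lambda>m. F m / real m) \<longlonglongrightarrow> (0 :: real)"
proof (rule tendsto_sandwich[OF _ _ tendsto_const])
  show "(\<lambda>m. G (level m) / real (start (level m))) \<longlonglongrightarrow> 0"
    using filterlim_compose[OF lim filterlim_level] .
  show "\<forall>\<^sub>F m in sequentially. 0 \<le> F m / real m" using nonneg by simp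
  have "\<forall>\<^sub>F m in sequentially. 2 \<le> level m"
    using filterlim_level by (simp add: filterlim_at_top)
  then show "\<forall>\<^sub>F m in sequentially. F m / real m \<le> G (level m) / real (start (level m))"
  proof eventually_elim
    case (elim m)
    have "F m \<le> G (level m)" by (rule le[OF start_level_le level_less])
    moreover have "0 < start (level m)" using elim by (intro start_pos) simp
    moreover have "start (level m) \<le> m" by (rule start_level_le)
    ultimately show ?case using nonneg[of m] by (intro frac_le) auto
  qed
qed

section \<open>The words of length \<open>n\<close> listed by block \<open>n\<close>\<close>

definition phrase :: "nat \<Rightarrow> nat \<Rightarrow> bool list" where
  "phrase n a = factor seq (start n + a * n) n"

lemma phrase_less: "a < 2 ^ n \<Longrightarrow> i < n \<Longrightarrow> a * n + i < n * (2::nat) ^ n"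
proof -
  assume "a < 2 ^ n" "i < n"
  then have "a * n + i < Suc a * n" "Suc a * n \<le> 2 ^ n * n"
    by (auto simp del: mult_Suc intro!: mult_right_mono) auto
  then show ?thesis by (simp add: mult.commute)
qed

lemma phrase_eq:
  assumes "a < 2 ^ n"
  shows "phrase n a = factor (db n) (a * n + a * n div lcm n (2 ^ n)) n"
  unfolding phrase_def factor_eq_iff
proof (intro allI impI)
  fix i assume i: "i < n"
  have "seq (start n + a * n + i) = db n (a * n + i + (a * n + i) div lcm n (2 ^ n))"
    using seq_start_add[OF phrase_less[OF assms i]] by (simp add: add.assoc)
  also have "(a * n + i) div lcm n (2 ^ n) = a * n div lcm n (2 ^ n)"
    using i by (intro div_mult_dvd_add) auto
  finally show "seq (start n + a * n + i) = db n (a * n + a * n div lcm n (2 ^ n) + i)"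
    by (simp add: ac_simps)
qed

text \<open>Equal words have equal phases modulo \<open>2 ^ n\<close>. Modulo \<open>g\<close> the
  multiples of \<open>n\<close> vanish and leave the shifts, which are below \<open>g\<close> and
  hence equal. Then \<open>a * n\<close> and \<open>b * n\<close> agree modulo \<open>2 ^ n\<close>
  and modulo \<open>n\<close>, so modulo \<open>l\<close>, and they have the same quotient by
  \<open>l\<close>.\<close>

lemma inj_on_phrase: "inj_on (phrase n) {..<2 ^ n}"
proof (rule linorder_inj_onI')
  fix a b :: nat assume ab: "a \<in> {..<2 ^ n}" "b \<in> {..<2 ^ n}" "a < b"
  show "phrase n a \<noteq> phrase n b"
  proof (cases "n = 0")
    case True then show ?thesis using ab by simp
  next
    case False
    define l g where "l = lcm n (2 ^ n)" and "g = gcd n (2 ^ n)"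
    have gl: "g * l = n * 2 ^ n" unfolding g_def l_def by simp
    have less: "c * n div l < g" if "c < 2 ^ n" for c
      using that False gl by (intro less_mult_imp_div_less) simp
    show ?thesis
    proof
      assume "phrase n a = phrase n b"
      then have "(a * n + a * n div l) mod 2 ^ n = (b * n + b * n div l) mod 2 ^ n"
        using ab by (simp add: phrase_eq factor_db_eq_iff l_def)
      then have eq: "[a * n + a * n div l = b * n + b * n div l] (mod 2 ^ n)" by (simp add: cong_def)
      then have "[a * n + a * n div l = b * n + b * n div l] (mod g)"
        by (rule cong_dvd_modulus_nat) (simp add: g_def)
      moreover have "[a * n + c = c] (mod g)" for a c
        by (simp add: cong_def g_def mod_add_left_eq flip: mod_add_left_eq[of "a * n"])
      ultimately have "[a * n div l = b * n div l] (mod g)"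
        by (meson cong_sym cong_trans)
      then have dv: "a * n div l = b * n div l"
        using less[of a] less[of b] ab by (simp add: cong_def)
      with eq have "[b * n = a * n] (mod 2 ^ n)" by (simp add: cong_add_rcancel_nat cong_sym_eq)
      then have "2 ^ n dvd b * n - a * n" using ab by (simp add: cong_altdef_nat)
      moreover have "n dvd b * n - a * n" by (simp flip: diff_mult_distrib)
      ultimately have "[b * n = a * n] (mod l)"
        using ab unfolding l_def by (simp add: cong_altdef_nat)
      then show False using dv ab False by (metis cong_def div_mult_mod_eq lessThan_iff mult_right_cancel nat_neq_iff)
    qed
  qed
qed

lemma image_phrase: "phrase n ` {..<2 ^ n} = {w. length w = n}"
proof (rule card_subset_eq[OF finite_words])
  show "card (phrase n ` {..<2 ^ n}) = card {w :: bool list. length w = n}"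
    by (simp add: card_image inj_on_phrase card_words)
qed (auto simp: phrase_def)

section \<open>Lempel-Ziv parsing\<close>

declare bin.simps [simp del] lz_parse.simps [simp del]

lemma length_bin: "2 ^ k \<le> v \<Longrightarrow> v < 2 ^ Suc k \<Longrightarrow> length (bin v) = Suc k"
proof (induction k arbitrary: v)
  case 0
  then show ?case by (simp add: bin.simps[of v])
next
  case (Suc k)
  have "(1 :: nat) < 2 ^ Suc k" by (rule one_less_power) simp_all
  then have "1 < v" using Suc.prems(1) by (rule less_le_trans)
  moreover have "2 ^ k \<le> v div 2" "v div 2 < 2 ^ Suc k" using Suc.prems by auto
  ultimately show ?case using Suc.IH[of "v div 2"] by (simp add: bin.simps[of v])
qed

lemma length_bin_le_log: "0 < k \<Longrightarrow> real (length (bin k)) \<le> log 2 (real k) + 1"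
proof -
  assume "0 < k"
  then obtain j where j: "2 ^ j \<le> k" "k < 2 ^ Suc j"
    using ex_power_ivl1[of 2 k] by auto
  then have "real j \<le> log 2 (real k)" by (intro le_log_of_power) (simp_all flip: of_nat_power)
  then show ?thesis using length_bin[OF j] by simp
qed

text \<open>The length of the code of an LZ78 phrase of length \<open>n\<close> of the sequence.\<close>

definition entry_length :: "nat \<Rightarrow> nat" where
  "entry_length n = n + 2 * length (bin n) - 1"

lemma length_bin_pos: "0 < length (bin n)"
  by (simp add: bin.simps[of n])

lemma le_entry_length: "n \<le> entry_length n"
  using length_bin_pos[of n] unfolding entry_length_def by linarith

text \<open>The number \<open>Suc j\<close> has \<open>n\<close> binary digits. Its Elias delta code
  spends \<open>2 * length (bin n) - 1\<close> bits on the digit count and \<open>n - 1\<close> on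
  the digits after the first; the outer \<open>Suc\<close> is the new bit of the phrase.\<close>

lemma length_ptr_code:
  assumes "0 < n" "2 ^ (n - 1) \<le> Suc j" "Suc j < 2 ^ n"
  shows "Suc (length (ptr_code j)) = entry_length n"
proof -
  have "length (bin (Suc j)) = n" using length_bin[of "n - 1" "Suc j"] assms by simp
  then show ?thesis
    using assms(1) length_bin_pos[of n]
    by (simp add: ptr_code_def elias_delta_def elias_gamma_def entry_length_def del: length_greater_0_conv)
qed

text \<open>Certifies that a known list is a legal LZ78 phrase list from dictionary
  \<open>D\<close>, so that the parse need not be computed through \<open>next_len\<close>.\<close>

fun lz_phrases :: "bool list list \<Rightarrow> bool list list \<Rightarrow> bool" where
  "lz_phrases D [] \<longleftrightarrow> True"
| "lz_phrases D (p # ps) \<longleftrightarrow>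
     p \<noteq> [] \<and> p \<notin> set D \<and> (\<forall>k. 1 \<le> k \<and> k < length p \<longrightarrow> take k p \<in> set D) \<and> lz_phrases (D @ [p]) ps"

fun lz_entries :: "bool list list \<Rightarrow> bool list list \<Rightarrow> (nat \<times> bool) list" where
  "lz_entries D [] = []"
| "lz_entries D (p # ps) = (ptr D (butlast p), last p) # lz_entries (D @ [p]) ps"

lemma lz_phrases_append: "lz_phrases D (ps @ qs) \<longleftrightarrow> lz_phrases D ps \<and> lz_phrases (D @ ps) qs"
  by (induction ps arbitrary: D) auto

lemma lz_entries_append: "lz_entries D (ps @ qs) = lz_entries D ps @ lz_entries (D @ ps) qs"
  by (induction ps arbitrary: D) auto

lemma next_len_append:
  assumes "p \<noteq> []" "p \<notin> set D" "\<And>k. 1 \<le> k \<Longrightarrow> k < length p \<Longrightarrow> take k p \<in> set D"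
  shows "next_len D (p @ w) = length p"
proof -
  let ?P = "\<lambda>k. 1 \<le> k \<and> k \<le> length (p @ w) \<and> take k (p @ w) \<notin> set D"
  have P: "?P (length p)" using assms by (simp add: Suc_le_eq)
  have "length p \<le> k" if "?P k" for k
  proof (rule ccontr)
    assume "\<not> length p \<le> k"
    then show False using that assms(3)[of k] by simp
  qed
  then have "(LEAST k. ?P k) = length p" using P by (intro Least_equality) auto
  moreover have "\<exists>k. ?P k" using P by blast
  ultimately show ?thesis unfolding next_len_def by (simp only: if_True)
qed

lemma lz_parse_append:
  "lz_phrases D ps \<Longrightarrow> lz_parse D (concat ps @ w) = lz_entries D ps @ lz_parse (D @ ps) w"
proof (induction ps arbitrary: D)
  case (Cons p ps)
  then have "next_len D (p @ concat ps @ w) = length p" by (intro next_len_append) auto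
  then have "lz_parse D (p @ concat ps @ w) = (ptr D (butlast p), last p) # lz_parse (D @ [p]) (concat ps @ w)"
    using Cons.prems by (subst lz_parse.simps) (simp add: Let_def)
  then show ?case using Cons by simp
qed simp

definition entries_length :: "(nat \<times> bool) list \<Rightarrow> nat" where
  "entries_length es = length (concat (map (\<lambda>(l, b). ptr_code l @ [b]) es))"

lemma entries_length_simps [simp]:
  "entries_length [] = 0"
  "entries_length ((l, b) # es) = Suc (length (ptr_code l)) + entries_length es"
  "entries_length (es @ es') = entries_length es + entries_length es'"
  by (simp_all add: entries_length_def)

lemma length_LZ_append:
  assumes "lz_phrases [] ps"
  shows "length (LZ (concat ps @ w)) = entries_length (lz_entries [] ps) + entries_length (lz_parse ps w)"
  using lz_parse_append[OF assms, of w] by (simp add: LZ_def flip: entries_length_def)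

section \<open>The LZ78 parse of the sequence\<close>

definition words :: "nat \<Rightarrow> nat \<Rightarrow> bool list list" where
  "words n a = map (phrase n) [0..<a]"

definition dict :: "nat \<Rightarrow> bool list list" where
  "dict n = concat (map (\<lambda>k. words k (2 ^ k)) [1..<n])"

lemma dict_Suc: "0 < n \<Longrightarrow> dict (Suc n) = dict n @ words n (2 ^ n)"
  by (simp add: dict_def)

lemma dict_1 [simp]: "dict (Suc 0) = []"
  by (simp add: dict_def)

lemma set_words: "set (words n (2 ^ n)) = {w. length w = n}"
  unfolding image_phrase[symmetric] by (simp add: words_def atLeast0LessThan)

lemma set_dict: "set (dict n) = {w. w \<noteq> [] \<and> length w < n}"
  by (auto simp: dict_def set_words Suc_le_eq)

lemma length_dict: "0 < n \<Longrightarrow> length (dict n) + 2 = 2 ^ n"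
  by (induction n rule: nat_induct_non_zero) (auto simp: dict_Suc words_def)

lemma words_Suc: "words n (Suc a) = words n a @ [phrase n a]"
  by (simp add: words_def)

lemma length_phrase [simp]: "length (phrase n a) = n"
  by (simp add: phrase_def)

lemma phrase_notin_words: "a < 2 ^ n \<Longrightarrow> phrase n a \<notin> set (words n a)"
  using inj_onD[OF inj_on_phrase[of n], of a] by (fastforce simp: words_def)

text \<open>The first copy of \<open>butlast p\<close> lies among the words of length
  \<open>n - 1\<close>, which occupy the dictionary indices from \<open>2 ^ (n - 1) - 2\<close> to
  \<open>2 ^ n - 3\<close>. The pointer is one more than the index, and the code adds another one.
  For \<open>n = 1\<close> the pointer is \<open>0\<close>.\<close>

lemma ptr_bounds:
  assumes "0 < n" "length p = n"
  shows "2 ^ (n - 1) \<le> Suc (ptr (dict n @ ps) (butlast p))" "Suc (ptr (dict n @ ps) (butlast p)) < 2 ^ n"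
proof -
  have "2 ^ (n - 1) \<le> Suc (ptr (dict n @ ps) (butlast p)) \<and> Suc (ptr (dict n @ ps) (butlast p)) < 2 ^ n"
  proof (cases "n = 1")
    case True
    then have "butlast p = []" using assms by (cases p) auto
    then show ?thesis using True by (simp add: ptr_def)
  next
    case False
    then obtain m where n: "n = Suc m" and m: "0 < m" using assms(1) by (cases n) auto
    let ?q = "butlast p" let ?D = "dict n @ ps"
    have q: "length ?q = m" "?q \<noteq> []" using assms n m by (auto simp flip: length_0_conv)
    let ?P = "\<lambda>i. i < length ?D \<and> ?D ! i = ?q"
    have "?q \<in> set (dict n)" using q n by (simp add: set_dict)
    then obtain i where i: "i < length (dict n)" "dict n ! i = ?q" by (auto simp: in_set_conv_nth)
    then have Pi: "?P i" by (simp add: nth_append)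
    define j where "j = (LEAST i. ?P i)"
    have Pj: "?P j" unfolding j_def by (rule LeastI) (rule Pi)
    have "j \<le> i" unfolding j_def by (rule Least_le) (rule Pi)
    then have upper: "j + 2 < 2 ^ n" using i length_dict[OF assms(1)] by linarith
    have "length (dict m) \<le> j"
    proof (rule ccontr)
      assume "\<not> length (dict m) \<le> j"
      then have "?q = dict m ! j" using Pj n m by (simp add: dict_Suc nth_append)
      then have "?q \<in> set (dict m)" using \<open>\<not> length (dict m) \<le> j\<close> by simp
      then show False using q by (simp add: set_dict)
    qed
    then have "2 ^ m \<le> j + 2" using length_dict[OF m] by linarith
    moreover have "ptr ?D ?q = Suc j" using q(2) by (simp add: ptr_def j_def)
    ultimately show ?thesis using upper n by simp
  qed
  then show "2 ^ (n - 1) \<le> Suc (ptr (dict n @ ps) (butlast p))" "Suc (ptr (dict n @ ps) (butlast p)) < 2 ^ n"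
    by auto
qed

text \<open>All proper nonempty prefixes of a word of length \<open>n\<close> are in
  \<open>dict n\<close>, the word itself is too long for \<open>dict n\<close>, and block
  \<open>n\<close> does not repeat it.\<close>

lemma lz_words:
  assumes "0 < n" "a \<le> 2 ^ n"
  shows "lz_phrases (dict n) (words n a) \<and>
    entries_length (lz_entries (dict n) (words n a)) = a * entry_length n"
  using assms(2)
proof (induction a)
  case 0
  then show ?case by (simp add: words_def)
next
  case (Suc a)
  let ?p = "phrase n a"
  have ne: "?p \<noteq> []" using assms(1) length_phrase[of n a] by (metis length_0_conv less_irrefl)
  moreover have "?p \<notin> set (dict n)" by (simp add: set_dict)
  moreover have "take k ?p \<in> set (dict n)" if "1 \<le> k" "k < n" for k
    using that ne by (simp add: set_dict)
  ultimately have "lz_phrases (dict n @ words n a) [?p]"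
    using phrase_notin_words[of a n] Suc.prems by simp
  moreover have "Suc (length (ptr_code (ptr (dict n @ words n a) (butlast ?p)))) = entry_length n"
    using assms(1) by (intro length_ptr_code ptr_bounds) auto
  ultimately show ?case using Suc by (simp add: words_Suc lz_phrases_append lz_entries_append)
qed

lemma lz_dict:
  assumes "0 < n"
  shows "lz_phrases [] (dict n) \<and>
    entries_length (lz_entries [] (dict n)) = (\<Sum>k=1..<n. 2 ^ k * entry_length k)"
  using assms
proof (induction n rule: nat_induct_non_zero)
  case (Suc n)
  then show ?case
    using lz_words[of n "2 ^ n"] by (simp add: dict_Suc lz_phrases_append lz_entries_append)
qed simp

lemma factor_add: "factor f i (l + k) = factor f i l @ factor f (i + l) k"
  unfolding factor_def using upt_add_eq_append[of i "i + l" k] by (simp add: add.assoc)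

lemma prefix_of_eq_factor: "prefix_of S m = factor S 0 m"
  by (simp add: prefix_of_def factor_def)

lemma concat_words: "concat (words n a) = factor seq (start n) (a * n)"
proof (induction a)
  case (Suc a)
  have "factor seq (start n) (Suc a * n) = factor seq (start n) (a * n) @ phrase n a"
    unfolding phrase_def by (subst factor_add[symmetric]) (simp add: add.commute)
  then show ?case using Suc by (simp add: words_Suc)
qed (simp add: words_def factor_def)

lemma concat_dict: "0 < n \<Longrightarrow> concat (dict n) = prefix_of seq (start n)"
proof (induction n rule: nat_induct_non_zero)
  case (Suc n)
  then show ?case
    by (simp add: dict_Suc concat_words prefix_of_eq_factor factor_add mult.commute)
qed (simp add: prefix_of_def start_Suc)

lemma level_pos: "0 < level m"
  using level_less[of m] by (cases "level m") auto

text \<open>Every complete phrase costs at least its own length. Only an incomplete last phrase of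
  fewer than \<open>level m\<close> bits remains, and its code is bounded below by
  \<open>0\<close>.\<close>

lemma length_LZ_ge: "m \<le> length (LZ (prefix_of seq m)) + level m"
proof -
  let ?n = "level m"
  have n: "0 < ?n" by (rule level_pos)
  define a where "a = (m - start ?n) div ?n"
  define r where "r = (m - start ?n) mod ?n"
  have m: "m = start ?n + (a * ?n + r)" using start_level_le[of m] unfolding a_def r_def by simp
  have r: "r < ?n" using n unfolding r_def by simp
  have "m - start ?n < 2 ^ ?n * ?n" using level_less[of m] start_level_le[of m]
    by (simp add: mult.commute less_diff_conv2)
  then have a: "a \<le> 2 ^ ?n" unfolding a_def by (intro less_imp_le less_mult_imp_div_less)
  have pre: "prefix_of seq m = concat (dict ?n @ words ?n a) @ factor seq (start ?n + a * ?n) r"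
    by (subst m) (simp add: concat_dict[OF n] concat_words prefix_of_eq_factor factor_add del: start_Suc)
  have "start ?n \<le> (\<Sum>k=1..<?n. 2 ^ k * entry_length k)"
  proof -
    have "start ?n = (\<Sum>k=1..<?n. k * 2 ^ k)"
      unfolding start_def by (rule sum.mono_neutral_right) (auto simp: not_less_eq_eq)
    also have "\<dots> \<le> (\<Sum>k=1..<?n. 2 ^ k * entry_length k)"
      by (rule sum_mono) (simp add: le_entry_length mult.commute)
    finally show ?thesis .
  qed
  moreover have "a * ?n \<le> a * entry_length ?n" by (simp add: le_entry_length)
  moreover have "length (LZ (prefix_of seq m)) \<ge> (\<Sum>k=1..<?n. 2 ^ k * entry_length k) + a * entry_length ?n"
    unfolding pre using lz_dict[OF n] lz_words[OF n a]
    by (subst length_LZ_append) (auto simp: lz_phrases_append lz_entries_append)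
  ultimately show ?thesis using m r by linarith
qed

lemma power2_sum_le: "(\<Sum>k<n. 2 ^ k :: real) \<le> 2 ^ n"
  by (induction n) auto

text \<open>For a liminf, an upper bound at block boundaries suffices. The code of a phrase exceeds
  the phrase by at most \<open>2 * log 2 n + 1\<close> bits, and there are fewer than
  \<open>2 ^ n\<close> phrases.\<close>

lemma length_LZ_start:
  assumes "0 < n"
  shows "real (length (LZ (prefix_of seq (start n)))) \<le> real (start n) + 2 ^ n * (2 * log 2 (real n) + 1)"
proof -
  have "length (LZ (prefix_of seq (start n))) = (\<Sum>k=1..<n. 2 ^ k * entry_length k)"
    using length_LZ_append[of "dict n" "[]"] lz_dict[OF assms] concat_dict[OF assms]
    by (simp add: lz_parse.simps)
  also have "real \<dots> \<le> (\<Sum>k=1..<n. real (k * 2 ^ k) + 2 ^ k * (2 * log 2 (real n) + 1))"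
    unfolding of_nat_sum
  proof (rule sum_mono)
    fix k assume k: "k \<in> {1..<n}"
    have "real (length (bin k)) \<le> log 2 (real k) + 1" using k by (intro length_bin_le_log) simp
    also have "log 2 (real k) \<le> log 2 (real n)" using k by simp
    finally have "real (entry_length k) \<le> real k + (2 * log 2 (real n) + 1)"
      using length_bin_pos[of k] by (simp add: entry_length_def of_nat_diff Suc_le_eq trans_le_add2)
    then have "2 ^ k * real (entry_length k) \<le> 2 ^ k * (real k + (2 * log 2 (real n) + 1))"
      by (rule mult_left_mono) simp
    then show "real (2 ^ k * entry_length k) \<le> real (k * 2 ^ k) + 2 ^ k * (2 * log 2 (real n) + 1)"
      by (simp add: algebra_simps)
  qed
  also have "\<dots> \<le> (\<Sum>k<n. real (k * 2 ^ k) + 2 ^ k * (2 * log 2 (real n) + 1))"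
    using assms by (intro sum_mono2) auto
  also have "\<dots> = real (start n) + (\<Sum>k<n. 2 ^ k) * (2 * log 2 (real n) + 1)"
    by (simp add: sum.distrib start_def sum_distrib_right)
  also have "\<dots> \<le> real (start n) + 2 ^ n * (2 * log 2 (real n) + 1)"
    using assms by (intro add_left_mono mult_right_mono) (auto simp: power2_sum_le)
  finally show ?thesis .
qed

lemma liminf_LZ: "liminf (\<lambda>m. ereal (real (length (LZ (prefix_of seq m))) / real m)) = 1"
proof (rule antisym)
  let ?f = "\<lambda>m. real (length (LZ (prefix_of seq m))) / real m"
  have "(\<lambda>m. real (level m) / real m) \<longlonglongrightarrow> 0"
  proof (rule average_tendsto_zero[where G = real])
    show "(\<lambda>n. real n / real (start n)) \<longlonglongrightarrow> 0" unfolding real_start by real_asymp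
  qed (use level_eqI in auto)
  then have "(\<lambda>m. 1 - real (level m) / real m) \<longlonglongrightarrow> 1 - 0" by (intro tendsto_diff tendsto_const)
  then have "liminf (\<lambda>m. ereal (1 - real (level m) / real m)) = ereal 1"
    by (intro lim_imp_Liminf tendsto_ereal) simp_all
  moreover have "liminf (\<lambda>m. ereal (1 - real (level m) / real m)) \<le> liminf (\<lambda>m. ereal (?f m))"
  proof (rule Liminf_mono)
    show "\<forall>\<^sub>F m in sequentially. ereal (1 - real (level m) / real m) \<le> ereal (?f m)"
      using eventually_gt_at_top[of 0]
    proof eventually_elim
      case (elim m)
      have "real m \<le> real (length (LZ (prefix_of seq m))) + real (level m)"
        using length_LZ_ge[of m] by linarith
      then show ?case using elim by (simp add: divide_simps del: of_nat_add)
    qed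
  qed
  ultimately show "1 \<le> liminf (\<lambda>m. ereal (?f m))" by (simp add: one_ereal_def)
  have "strict_mono (\<lambda>n. start (Suc n))" by (simp add: strict_mono_Suc_iff)
  then have "liminf (\<lambda>m. ereal (?f m)) \<le> liminf ((\<lambda>m. ereal (?f m)) \<circ> (\<lambda>n. start (Suc n)))"
    by (rule liminf_subseq_mono)
  also have "\<dots> \<le> liminf (\<lambda>n. ereal (1 + 2 ^ Suc n * (2 * log 2 (real (Suc n)) + 1) / real (start (Suc n))))"
  proof (rule Liminf_mono)
    show "\<forall>\<^sub>F n in sequentially. ((\<lambda>m. ereal (?f m)) \<circ> (\<lambda>n. start (Suc n))) n
      \<le> ereal (1 + 2 ^ Suc n * (2 * log 2 (real (Suc n)) + 1) / real (start (Suc n)))"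
      using eventually_gt_at_top[of 0]
    proof eventually_elim
      case (elim n)
      then have "0 < start (Suc n)" by (intro start_pos) simp
      then show ?case
        using divide_right_mono[OF length_LZ_start[of "Suc n"], of "real (start (Suc n))"]
        by (simp add: add_divide_distrib del: start_Suc)
    qed
  qed
  also have "\<dots> = ereal 1"
  proof (intro lim_imp_Liminf tendsto_ereal)
    show "(\<lambda>n. 1 + 2 ^ Suc n * (2 * log 2 (real (Suc n)) + 1) / real (start (Suc n))) \<longlonglongrightarrow> 1"
      unfolding real_start by real_asymp
  qed simp
  finally show "liminf (\<lambda>m. ereal (?f m)) \<le> 1" by (simp add: one_ereal_def)
qed

section \<open>Normality\<close>

lemma take_drop_prefix_of: "i + l \<le> m \<Longrightarrow> take l (drop i (prefix_of S m)) = factor S i l"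
  by (rule nth_equalityI) (simp_all add: prefix_of_def)

lemma length_prefix_of [simp]: "length (prefix_of S m) = m"
  by (simp add: prefix_of_def)

lemma occ_prefix_of: "occ w (prefix_of S m) = card {i. i + length w \<le> m \<and> factor S i (length w) = w}"
  unfolding occ_def by (intro arg_cong[of _ _ card]) (auto simp: take_drop_prefix_of)

lemma card_words_take:
  assumes "length w \<le> k"
  shows "card {u :: bool list. length u = k \<and> take (length w) u = w} = 2 ^ (k - length w)"
proof -
  have "{u :: bool list. length u = k \<and> take (length w) u = w} = (@) w ` {v. length v = k - length w}"
  proof (intro equalityI subsetI)
    fix u assume "u \<in> {u :: bool list. length u = k \<and> take (length w) u = w}"
    then show "u \<in> (@) w ` {v. length v = k - length w}"
      by (intro image_eqI[of _ _ "drop (length w) u"]) (auto, metis append_take_drop_id)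
  qed (use assms in auto)
  moreover have "inj_on ((@) w) {v. length v = k - length w}" by (simp add: inj_on_def)
  ultimately show ?thesis by (simp add: card_image card_words)
qed

lemma real_power_diff: "l \<le> k \<Longrightarrow> real (2 ^ (k - l)) = 2 ^ k / 2 ^ l"
  unfolding of_nat_power by (subst power_diff) simp_all

lemma inj_on_factor_db: "inj_on (\<lambda>i. factor (db k) (i + r) k) {..<2 ^ k}"
proof (rule inj_onI)
  fix i j assume ij: "i \<in> {..<2 ^ k}" "j \<in> {..<2 ^ k}"
    "factor (db k) (i + r) k = factor (db k) (j + r) k"
  then have "[i + r = j + r] (mod 2 ^ k)" by (simp add: factor_db_eq_iff cong_def)
  then have "[i = j] (mod 2 ^ k)" by (simp add: cong_add_rcancel_nat)
  then show "i = j" using ij by (simp add: cong_def)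
qed

lemma take_factor: "l \<le> k \<Longrightarrow> take l (factor f i k) = factor f i l"
  by (simp add: factor_def take_map min_def)

text \<open>Each word \<open>u\<close> of length \<open>k\<close> occurs at exactly one offset, so
  what is counted are the extensions \<open>u\<close> of \<open>w\<close>.\<close>

lemma card_factor_db:
  assumes "length w \<le> k"
  shows "card {i. i < 2 ^ k \<and> factor (db k) (i + r) (length w) = w} = 2 ^ (k - length w)"
proof -
  let ?f = "\<lambda>i. factor (db k) (i + r) k"
  have image: "?f ` {..<2 ^ k} = {u. length u = k}"
    by (rule card_subset_eq[OF finite_words]) (auto simp: card_image inj_on_factor_db card_words)
  have "?f ` {i. i < 2 ^ k \<and> factor (db k) (i + r) (length w) = w} = {u. length u = k \<and> take (length w) u = w}"
    (is "?f ` ?A = ?B")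
  proof (intro equalityI subsetI)
    fix u assume u: "u \<in> ?B"
    then have "u \<in> ?f ` {..<2 ^ k}" unfolding image by simp
    then show "u \<in> ?f ` ?A" using u assms by (auto simp: take_factor)
  qed (use assms in \<open>auto simp: take_factor\<close>)
  moreover have "inj_on ?f ?A" by (rule inj_on_subset[OF inj_on_factor_db]) auto
  ultimately show ?thesis using card_words_take[OF assms] card_image[of ?f ?A] by simp
qed

lemma factor_seq_pos:
  assumes "\<rho> < n" "i + l \<le> 2 ^ n"
  shows "factor seq (pos n \<rho> i) l = factor (db n) (i + rot n \<rho>) l"
proof -
  have "seq (pos n \<rho> i + j) = db n (i + rot n \<rho> + j)" if "j < l" for j
    using seq_pos[of \<rho> n "i + j"] assms that by (simp add: pos_def ac_simps)
  then show ?thesis by (simp add: factor_eq_iff)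
qed

definition excess :: "bool list \<Rightarrow> nat \<Rightarrow> real" where
  "excess w t = of_bool (factor seq t (length w) = w) - 1 / 2 ^ length w"

lemma abs_excess_le: "\<bar>excess w t\<bar> \<le> 1"
  by (auto simp: excess_def)

text \<open>If \<open>length w \<le> k\<close>, the cyclic count is exact, so \<open>h\<close> sums
  to \<open>0\<close>; the true windows differ from the cyclic ones only at the last
  \<open>length w\<close> offsets, where they may leave the rotation. If \<open>w\<close> is longer,
  \<open>2 ^ k\<close> is a trivial bound.\<close>

lemma excess_piece:
  assumes "\<rho> < k"
  shows "\<bar>\<Sum>i<2 ^ k. excess w (pos k \<rho> i)\<bar> \<le> real (length w) + 2 ^ length w"
proof (cases "length w \<le> k")
  case True
  let ?l = "length w"
  define h :: "nat \<Rightarrow> real" where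
    "h i = of_bool (factor (db k) (i + rot k \<rho>) ?l = w) - 1 / 2 ^ ?l" for i
  have "(\<Sum>i<2 ^ k. of_bool (factor (db k) (i + rot k \<rho>) ?l = w)) =
      real (card {i. i < 2 ^ k \<and> factor (db k) (i + rot k \<rho>) ?l = w})"
    by (simp add: of_bool_def Collect_conj_eq lessThan_def flip: sum.inter_filter)
  also have "\<dots> = 2 ^ k / 2 ^ ?l"
    unfolding card_factor_db[OF True] by (rule real_power_diff[OF True])
  finally have h0: "(\<Sum>i<2 ^ k. h i) = 0" by (simp add: h_def sum_subtractf)
  have "(\<Sum>i<2 ^ k. excess w (pos k \<rho> i)) = (\<Sum>i<2 ^ k. excess w (pos k \<rho> i) - h i)"
    by (simp add: sum_subtractf h0)
  also have "\<dots> = (\<Sum>i\<in>{2 ^ k - ?l..<2 ^ k}. excess w (pos k \<rho> i) - h i)"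
  proof (rule sum.mono_neutral_right)
    show "\<forall>i\<in>{..<2 ^ k} - {2 ^ k - ?l..<2 ^ k}. excess w (pos k \<rho> i) - h i = 0"
      using factor_seq_pos[OF assms] by (auto simp: excess_def h_def)
  qed auto
  also have "\<bar>\<dots>\<bar> \<le> (\<Sum>i\<in>{2 ^ k - ?l..<2 ^ k}. 1)"
    by (rule order_trans[OF sum_abs sum_mono]) (auto simp: excess_def h_def)
  also have "\<dots> = real (card {2 ^ k - ?l..<2 ^ k})" by (simp only: sum_constant mult_1_right)
  also have "\<dots> \<le> real ?l" by (rule of_nat_mono) simp
  finally show ?thesis by (rule order_trans) simp
next
  case False
  have "\<bar>\<Sum>i<2 ^ k. excess w (pos k \<rho> i)\<bar> \<le> (\<Sum>i<(2 :: nat) ^ k. 1)"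
    by (rule order_trans[OF sum_abs sum_mono]) (rule abs_excess_le)
  also have "\<dots> = 2 ^ k" by simp
  also have "\<dots> \<le> (2 :: real) ^ length w" using False by (intro power_increasing) auto
  finally show ?thesis by simp
qed

text \<open>At most \<open>n * n + n\<close> complete rotations precede \<open>m\<close>. The
  incomplete one contributes at most \<open>2 ^ n\<close>, which is small against
  \<open>start n\<close>.\<close>

lemma excess_le:
  assumes "start n \<le> m" "m < start (Suc n)"
  shows "\<bar>\<Sum>t<m. excess w t\<bar> \<le> (real n * real n + real n) * (real (length w) + 2 ^ length w) + 2 ^ n"
proof -
  let ?C = "real (length w) + 2 ^ length w"
  define \<rho> where "\<rho> = (m - start n) div 2 ^ n"
  define r where "r = (m - start n) mod 2 ^ n"
  have m: "m = start n + (\<rho> * 2 ^ n + r)" 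
    unfolding \<rho>_def r_def div_mult_mod_eq using assms(1) by simp
  have \<rho>: "\<rho> < n" unfolding \<rho>_def using assms by (intro less_mult_imp_div_less) (simp add: less_diff_conv2)
  have r: "r < 2 ^ n" unfolding r_def by simp
  have "(\<Sum>t<m. excess w t) = (\<Sum>k<n. \<Sum>\<rho><k. \<Sum>i<2 ^ k. excess w (pos k \<rho> i)) +
      ((\<Sum>\<rho>'<\<rho>. \<Sum>i<2 ^ n. excess w (pos n \<rho>' i)) + (\<Sum>i<r. excess w (pos n \<rho> i)))"
    unfolding m by (simp add: sum_lessThan_add sum_lessThan_mult sum_start pos_def add.assoc)
  also have "\<bar>\<dots>\<bar> \<le> real n * real n * ?C + (real n * ?C + 2 ^ n)"
  proof (intro order_trans[OF abs_triangle_ineq] add_mono)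
    have "\<bar>\<Sum>k<n. \<Sum>\<rho><k. \<Sum>i<2 ^ k. excess w (pos k \<rho> i)\<bar> \<le> (\<Sum>k<n. \<Sum>\<rho><k. ?C)"
      by (rule order_trans[OF sum_abs sum_mono], rule order_trans[OF sum_abs sum_mono])
        (simp add: excess_piece)
    also have "\<dots> \<le> (\<Sum>k<n. real n * ?C)" by (intro sum_mono) (simp add: mult_right_mono)
    finally show "\<bar>\<Sum>k<n. \<Sum>\<rho><k. \<Sum>i<2 ^ k. excess w (pos k \<rho> i)\<bar> \<le> real n * real n * ?C" by simp
    have "\<bar>\<Sum>\<rho>'<\<rho>. \<Sum>i<2 ^ n. excess w (pos n \<rho>' i)\<bar> \<le> (\<Sum>\<rho>'<\<rho>. ?C)"
      using \<rho> by (intro order_trans[OF sum_abs] sum_mono excess_piece) auto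
    also have "\<dots> \<le> real n * ?C" using \<rho> by (simp add: mult_right_mono)
    finally show "\<bar>\<Sum>\<rho>'<\<rho>. \<Sum>i<2 ^ n. excess w (pos n \<rho>' i)\<bar> \<le> real n * ?C" .
    have "\<bar>\<Sum>i<r. excess w (pos n \<rho> i)\<bar> \<le> (\<Sum>i<r. 1)"
      by (intro order_trans[OF sum_abs] sum_mono abs_excess_le)
    also have "\<dots> = real r" by simp
    also have "\<dots> \<le> real (2 ^ n)" using r by (intro of_nat_mono less_imp_le)
    finally show "\<bar>\<Sum>i<r. excess w (pos n \<rho> i)\<bar> \<le> 2 ^ n" by simp
  qed
  finally show ?thesis by (simp add: algebra_simps)
qed

lemma occ_excess:
  "\<bar>real (occ w (prefix_of seq m)) - real m / 2 ^ length w\<bar> \<le> \<bar>\<Sum>t<m. excess w t\<bar> + real (length w) + 1"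
proof -
  let ?l = "length w" and ?P = "\<lambda>t. factor seq t (length w) = w"
  let ?A = "{t. t < m \<and> ?P t}" and ?B = "{t. t + ?l \<le> m \<and> ?P t}"
  have sum: "(\<Sum>t<m. excess w t) = real (card ?A) - real m / 2 ^ ?l"
    unfolding excess_def sum_subtractf
    by (simp add: of_bool_def Collect_conj_eq lessThan_def flip: sum.inter_filter)
  have "?A \<subseteq> ?B \<union> {m - ?l..<m}" by auto
  then have "card ?A \<le> card (?B \<union> {m - ?l..<m})"
    by (rule card_mono[rotated]) (auto intro: finite_subset[of _ "{..m}"])
  also have "\<dots> \<le> card ?B + card {m - ?l..<m}" by (rule card_Un_le)
  also have "\<dots> \<le> card ?B + ?l" by simp
  finally have 1: "card ?A \<le> card ?B + ?l" .
  \<comment> \<open>The position \<open>m\<close> itself counts as an occurrence when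
    \<open>w\<close> is empty.\<close>
  have "card ?B \<le> card (insert m ?A)" by (rule card_mono) auto
  then have 2: "card ?B \<le> card ?A + 1" by simp
  show ?thesis using 1 2 unfolding occ_prefix_of sum by linarith
qed

lemma normal_seq: "normal seq"
  unfolding normal_def
proof
  fix w
  let ?f = "\<lambda>m. real (occ w (prefix_of seq m)) / real m"
  let ?F = "\<lambda>m. \<bar>real (occ w (prefix_of seq m)) - real m / 2 ^ length w\<bar>"
  let ?G = "\<lambda>n. (real n * real n + real n) * (real (length w) + 2 ^ length w) + 2 ^ n + real (length w) + 1"
  have "(\<lambda>m. ?F m / real m) \<longlonglongrightarrow> 0"
  proof (rule average_tendsto_zero[where G = ?G])
    show "?F m \<le> ?G n" if "start n \<le> m" "m < start (Suc n)" for n m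
      using excess_le[OF that, of w] occ_excess[of w m] by linarith
    show "(\<lambda>n. ?G n / real (start n)) \<longlonglongrightarrow> 0" unfolding real_start by real_asymp
  qed simp
  then have "(\<lambda>m. ?f m - 1 / 2 ^ length w) \<longlonglongrightarrow> 0"
  proof (rule tendsto_rabs_zero_cancel[OF Lim_transform_eventually])
    show "\<forall>\<^sub>F m in sequentially. ?F m / real m = \<bar>?f m - 1 / 2 ^ length w\<bar>"
      using eventually_gt_at_top[of 0]
    proof eventually_elim
      case (elim m)
      then have "?f m - 1 / 2 ^ length w = (real (occ w (prefix_of seq m)) - real m / 2 ^ length w) / real m"
        by (simp add: diff_divide_distrib)
      then show ?case by (simp add: abs_divide)
    qed
  qed
  then show "?f \<longlonglongrightarrow> 1 / 2 ^ length w" by (simp add: LIM_zero_iff)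
qed

section \<open>PPM* contexts\<close>

lemma finite_occ: "finite {i. i + length w \<le> length x \<and> take (length w) (drop i x) = w}"
  by (rule finite_subset[of _ "{..length x}"]) auto

lemma occ_append_le_left: "occ (u @ v) x \<le> occ u x"
  unfolding occ_def
proof (rule card_mono[OF finite_occ], rule subsetI)
  fix i assume "i \<in> {i. i + length (u @ v) \<le> length x \<and> take (length (u @ v)) (drop i x) = u @ v}"
  then have len: "i + length u \<le> length x" and eq: "take (length u + length v) (drop i x) = u @ v" by auto
  have "take (length u) (drop i x) = take (length u) (take (length u + length v) (drop i x))" by (simp add: min_def)
  then show "i \<in> {i. i + length u \<le> length x \<and> take (length u) (drop i x) = u}"
    using len eq by simp
qed

lemma occ_append_le_right: "occ (u @ v) x \<le> occ v x"
  unfolding occ_def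
proof (rule card_inj_on_le[of "\<lambda>i. i + length u", OF _ _ finite_occ])
  show "(\<lambda>i. i + length u) ` {i. i + length (u @ v) \<le> length x \<and> take (length (u @ v)) (drop i x) = u @ v}
      \<subseteq> {i. i + length v \<le> length x \<and> take (length v) (drop i x) = v}"
  proof (rule image_subsetI)
    fix i assume "i \<in> {i. i + length (u @ v) \<le> length x \<and> take (length (u @ v)) (drop i x) = u @ v}"
    then have len: "i + length u + length v \<le> length x" and eq: "take (length u + length v) (drop i x) = u @ v"
      by auto
    have "take (length v) (drop (i + length u) x) = drop (length u) (take (length u + length v) (drop i x))"
      by (simp add: drop_take add.commute)
    then show "i + length u \<in> {i. i + length v \<le> length x \<and> take (length v) (drop i x) = v}"
      using len eq by simp
  qed
qed (simp add: inj_on_def)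

lemma cnt_append_le: "cnt x (u @ v) b \<le> cnt x v b"
  unfolding cnt_def using occ_append_le_right[of u "v @ [b]" x] by simp

lemma cnt_drop_mono: "i \<le> j \<Longrightarrow> cnt x (drop i y) b \<le> cnt x (drop j y) b"
  using cnt_append_le[of x "take (j - i) (drop i y)" "drop j y" b]
  by (metis append_take_drop_id drop_drop le_add_diff_inverse2)

lemma cnt_le_occ: "cnt x c False + cnt x c True \<le> occ c x"
proof -
  let ?A = "\<lambda>b. {i. i + length (c @ [b]) \<le> length x \<and> take (length (c @ [b])) (drop i x) = c @ [b]}"
  have "?A False \<inter> ?A True = {}" by auto
  then have "cnt x c False + cnt x c True = card (?A False \<union> ?A True)"
    unfolding cnt_def occ_def by (intro card_Un_disjoint[symmetric] finite_occ)
  also have "\<dots> \<le> occ c x"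
    unfolding occ_def
  proof (rule card_mono[OF finite_occ], rule subsetI)
    fix i assume "i \<in> ?A False \<union> ?A True"
    then have len: "i + length c < length x" and "\<exists>b. take (Suc (length c)) (drop i x) = c @ [b]" by auto
    then obtain b where b: "take (Suc (length c)) (drop i x) = c @ [b]" by blast
    have "take (length c) (drop i x) = take (length c) (take (Suc (length c)) (drop i x))" by (simp add: min_def)
    also have "\<dots> = c" unfolding b by simp
    finally show "i \<in> {i. i + length c \<le> length x \<and> take (length c) (drop i x) = c}" using len by simp
  qed
  finally show ?thesis .
qed

lemma esc_eq: "esc x c = of_bool (0 < cnt x c False) + of_bool (0 < cnt x c True)"
proof -
  have "{b. 0 < occ (c @ [b]) x} =
      (if 0 < cnt x c False then {False} else {}) \<union> (if 0 < cnt x c True then {True} else {})"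
    (is "?L = ?R")
  proof (rule set_eqI)
    fix b show "b \<in> ?L \<longleftrightarrow> b \<in> ?R" by (cases b) (auto simp: cnt_def)
  qed
  then show ?thesis by (simp add: esc_def)
qed

lemma cnt_not_eq_0: "deterministic x c \<Longrightarrow> 0 < cnt x c b \<Longrightarrow> cnt x c (\<not> b) = 0"
  by (cases b) (auto simp: deterministic_def esc_eq)

lemma code_prob_pos: "0 < code_prob x b cs"
proof (induction x b cs rule: code_prob.induct)
  case (2 x b c cs)
  then show ?case by (cases b) (auto simp: Let_def esc_eq)
qed simp

lemma code_prob_neq_0 [simp]: "code_prob x b cs \<noteq> 0"
  using code_prob_pos[of x b cs] by simp

lemma of_nat_ratio_le_1: "a \<le> b \<Longrightarrow> real a / real b \<le> 1"
  by (cases "b = 0") (simp_all add: divide_le_eq_1)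

lemma code_prob_le_1: "code_prob x b cs \<le> 1"
proof (induction x b cs rule: code_prob.induct)
  case (2 x b c cs)
  define T where "T = cnt x c False + cnt x c True"
  have "cnt x c b \<le> T" by (cases b) (simp_all add: T_def)
  then have "real (cnt x c b) / real (T + esc x c) \<le> 1" by (intro of_nat_ratio_le_1) simp
  moreover have "real (esc x c) / real (T + esc x c) \<le> 1"
    by (intro of_nat_ratio_le_1) simp
  moreover have "code_prob x b cs \<le> 1" if "cnt x c b = 0" using 2 that by simp
  ultimately show ?case
    using code_prob_pos[of x b cs]
    by (simp add: Let_def mult_le_one less_imp_le del: of_nat_add flip: T_def)
qed simp

text \<open>Closure under suffixes makes the relevant contexts exactly the suffixes from some index
  on.\<close>

lemma stored_append: "stored x (u @ v) \<Longrightarrow> stored x v"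
proof (cases "v = []")
  case False
  assume "stored x (u @ v)"
  then obtain b where occ: "2 \<le> occ (u @ butlast v) x" and b: "0 < occ (u @ v @ [b]) x"
    using False by (auto simp: stored_def butlast_append)
  have "2 \<le> occ (butlast v) x" using occ occ_append_le_right[of u "butlast v" x] by linarith
  moreover have "0 < occ (v @ [b]) x" using b occ_append_le_right[of u "v @ [b]" x] by linarith
  ultimately show ?thesis by (auto simp: stored_def)
qed (simp add: stored_def)

lemma stored_drop_mono: "stored x (drop i y) \<Longrightarrow> i \<le> j \<Longrightarrow> stored x (drop j y)"
  using stored_append[of x "take (j - i) (drop i y)" "drop j y"]
  by (metis append_take_drop_id drop_drop le_add_diff_inverse2)

lemma relevant_eq:
  obtains i where "i \<le> length x" "relevant x = map (\<lambda>j. drop j x) [i..<Suc (length x)]"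
    "\<And>j. j \<le> length x \<Longrightarrow> stored x (drop j x) \<longleftrightarrow> i \<le> j"
proof -
  define i where "i = (LEAST j. stored x (drop j x))"
  have n: "stored x (drop (length x) x)" by (simp add: stored_def)
  have "i \<le> length x" unfolding i_def by (rule Least_le) (rule n)
  moreover have "stored x (drop i x)" unfolding i_def by (rule LeastI) (rule n)
  then have iff: "stored x (drop j x) \<longleftrightarrow> i \<le> j" for j
    using stored_drop_mono[of x i x j] by (auto simp: i_def Least_le)
  moreover have "[0..<Suc (length x)] = [0..<i] @ [i..<Suc (length x)]"
    using \<open>i \<le> length x\<close> upt_add_eq_append[of 0 i "Suc (length x) - i"] by (simp del: upt_Suc)
  then have "relevant x = map (\<lambda>j. drop j x) [i..<Suc (length x)]"
    unfolding relevant_def filter_map o_def iff by (simp add: filter_id_conv)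
  ultimately show ?thesis by (intro that[of i]) auto
qed

text \<open>Contexts are indexed by the number of dropped letters, so a larger index is a shorter
  context. The index \<open>i\<close> belongs to the shortest deterministic relevant context, or to
  the longest relevant one if none is deterministic.\<close>

lemma ctx_chain_eq:
  obtains i where "i \<le> length x" "ctx_chain x = map (\<lambda>j. drop j x) [i..<Suc (length x)]"
    "\<And>j. i \<le> j \<Longrightarrow> j \<le> length x \<Longrightarrow> stored x (drop j x)"
    "\<And>j. i < j \<Longrightarrow> j \<le> length x \<Longrightarrow> \<not> deterministic x (drop j x)"
    "\<And>j. j \<le> length x \<Longrightarrow> stored x (drop j x) \<Longrightarrow> deterministic x (drop j x) \<Longrightarrow>
       j \<le> i \<and> deterministic x (drop i x)"
    "\<And>j. j \<le> length x \<Longrightarrow> stored x (drop j x) \<Longrightarrow> \<not> deterministic x (drop i x) \<Longrightarrow> i \<le> j"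
proof -
  let ?n = "length x" and ?d = "\<lambda>j. drop j x"
  obtain i0 where i0: "i0 \<le> ?n" "relevant x = map ?d [i0..<Suc ?n]"
    and st: "\<And>j. j \<le> ?n \<Longrightarrow> stored x (?d j) \<longleftrightarrow> i0 \<le> j"
    using relevant_eq[of x] by blast
  show ?thesis
  proof (cases "\<exists>c\<in>set (relevant x). deterministic x c")
    case False
    then have nd: "\<not> deterministic x (?d j)" if "i0 \<le> j" "j \<le> ?n" for j
      using that by (auto simp: i0(2) simp del: upt_Suc)
    moreover have "ctx_chain x = map ?d [i0..<Suc ?n]" using False i0 by (simp only: ctx_chain_def if_False)
    ultimately show ?thesis using i0 st by (intro that[of i0]) auto
  next
    case True
    define J where "J = {j. i0 \<le> j \<and> j \<le> ?n \<and> deterministic x (?d j)}"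
    have J: "finite J" "J \<noteq> {}" using True by (auto simp: J_def i0(2) less_Suc_eq_le simp del: upt_Suc)
    define i where "i = Max J"
    have "i \<in> J" unfolding i_def using J by (rule Max_in)
    then have i: "i0 \<le> i" "i \<le> ?n" "deterministic x (?d i)" by (auto simp: J_def)
    have max: "j \<le> i" if "j \<in> J" for j unfolding i_def using J that by simp
    then have nd: "\<not> deterministic x (?d j)" if "i < j" "j \<le> ?n" for j
      using max[of j] that i(1) unfolding J_def by (metis (mono_tags, lifting) leD less_imp_le mem_Collect_eq order_trans)
    have split: "[i0..<Suc ?n] = [i0..<i] @ i # [Suc i..<Suc ?n]"
      using i upt_add_eq_append[of i0 i "Suc ?n - i"] by (simp add: upt_conv_Cons[of i] del: upt_Suc)
    have "filter (deterministic x) (map ?d [Suc i..<Suc ?n]) = []"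
      using nd by (auto simp: filter_empty_conv simp del: upt_Suc)
    then have last: "last (filter (deterministic x) (relevant x)) = ?d i"
      unfolding i0(2) split by (simp add: i(3) del: upt_Suc)
    have "?d j \<noteq> ?d i" if "j < i" for j
      using that i(2) by (metis diff_less_mono2 length_drop less_irrefl order_less_le_trans)
    then have "dropWhile (\<lambda>c. c \<noteq> ?d i) (relevant x) = map ?d (i # [Suc i..<Suc ?n])"
      unfolding i0(2) split map_append by (subst dropWhile_append2) auto
    then have "ctx_chain x = map ?d [i..<Suc ?n]"
      using True i by (simp add: ctx_chain_def last upt_conv_Cons del: upt_Suc)
    then show ?thesis using i st nd max by (intro that[of i]) (auto simp: J_def)
  qed
qed

text \<open>The current context is deterministic too and no longer than \<open>drop j x\<close>. Its
  count of \<open>b\<close> is therefore at least \<open>M\<close>, no escape occurs, and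
  \<open>M / Suc M\<close> increases with \<open>M\<close>.\<close>

lemma code_prob_deterministic:
  assumes "j \<le> length x" "stored x (drop j x)" "deterministic x (drop j x)" "0 < M" "M \<le> cnt x (drop j x) b"
  shows "real M / real (Suc M) \<le> code_prob x b (ctx_chain x)"
proof -
  obtain i where i: "i \<le> length x" "ctx_chain x = map (\<lambda>j. drop j x) [i..<Suc (length x)]"
    "j \<le> i" "deterministic x (drop i x)"
    using ctx_chain_eq[of x] assms by metis
  define f where "f = cnt x (drop i x) b"
  have "M \<le> f" using cnt_drop_mono[OF i(3), of x x b] assms unfolding f_def by linarith
  moreover have "cnt x (drop i x) False + cnt x (drop i x) True = f" "esc x (drop i x) = 1"
    using cnt_not_eq_0[OF i(4), of b] i(4) assms(4) \<open>M \<le> f\<close>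
    by (cases b; simp add: f_def deterministic_def)+
  ultimately have "code_prob x b (ctx_chain x) = real f / real (Suc f)"
    using i(1) assms(4) by (simp add: i(2) upt_conv_Cons Let_def flip: f_def del: upt_Suc)
  moreover have "real M / real (Suc M) \<le> real f / real (Suc f)"
    using \<open>M \<le> f\<close> by (simp add: divide_simps algebra_simps)
  ultimately show ?thesis by simp
qed

text \<open>
  If the suffix \<open>drop j x\<close> has been seen with both continuations, then at most one escape occurs,
  and both contexts involved extend that suffix.
\<close>

lemma code_prob_general:
  assumes j: "j \<le> length x" "stored x (drop j x)"
    and pos: "\<And>b. 0 < cnt x (drop j x) b"
    and N: "cnt x (drop j x) False + cnt x (drop j x) True \<le> N"
  shows "1 / real (N + 2) ^ 2 \<le> code_prob x b (ctx_chain x)"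
proof -
  obtain i where i: "i \<le> length x" "ctx_chain x = map (\<lambda>j. drop j x) [i..<Suc (length x)]"
    and st: "\<And>j. i \<le> j \<Longrightarrow> j \<le> length x \<Longrightarrow> stored x (drop j x)"
    and nd: "\<And>j. i < j \<Longrightarrow> j \<le> length x \<Longrightarrow> \<not> deterministic x (drop j x)"
    and le: "\<not> deterministic x (drop i x) \<Longrightarrow> i \<le> j"
    using ctx_chain_eq[of x] j by metis
  let ?T = "\<lambda>k. cnt x (drop k x) False + cnt x (drop k x) True"
  have two: "esc x (drop k x) = 2" if "j \<le> k" for k
    using cnt_drop_mono[OF that, of x x False] cnt_drop_mono[OF that, of x x True] pos[of False] pos[of True]
    by (simp add: esc_eq)
  \<comment> \<open>Were the current context shorter than \<open>drop j x\<close>, both bits would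
    have followed it. Then it would be nondeterministic, hence the longest relevant one, which it is
    not.\<close>
  have ij: "i \<le> j"
    using le two[of i] by (force simp: deterministic_def)
  have T: "?T k \<le> N" if "k \<le> j" for k
    using cnt_drop_mono[OF that, of x x False] cnt_drop_mono[OF that, of x x True] N by linarith
  have e2: "esc x c \<le> 2" for c by (simp add: esc_eq)
  have hit: "1 / real (N + 2) \<le> real f / real (?T k + esc x (drop k x))"
    if "k \<le> j" "0 < f" "0 < esc x (drop k x)" for k f
    using T[OF that(1)] e2[of "drop k x"] that by (intro frac_le) auto
  have esc_pos: "0 < esc x (drop k x)" if "i \<le> k" "k \<le> j" for k
  proof (cases "k = j")
    case True then show ?thesis using two by simp
  next
    case False
    then have "drop k x \<noteq> []" "stored x (drop k x)" using st[of k] that j(1) by auto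
    then obtain b where "0 < cnt x (drop k x) b" by (auto simp: stored_def cnt_def)
    then show ?thesis by (cases b) (auto simp: esc_eq)
  qed
  have sq: "1 / real (N + 2) ^ 2 = 1 / real (N + 2) * (1 / real (N + 2))" by (simp add: power2_eq_square)
  have chain: "ctx_chain x = drop i x # map (\<lambda>j. drop j x) [Suc i..<Suc (length x)]"
    using i by (simp add: upt_conv_Cons del: upt_Suc)
  show ?thesis
  proof (cases "0 < cnt x (drop i x) b")
    case True
    then have "code_prob x b (ctx_chain x) = real (cnt x (drop i x) b) / real (?T i + esc x (drop i x))"
      by (simp add: chain Let_def)
    moreover have "1 / real (N + 2) ^ 2 \<le> 1 / real (N + 2)" 
      using self_le_power[of "real (N + 2)" 2] by (intro divide_left_mono) auto
    ultimately show ?thesis using hit[OF ij True] esc_pos[of i] ij by simp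
  next
    case False
    then have "i < j" using ij pos[of b] by (cases "i = j") auto
    \<comment> \<open>The next shorter context is nondeterministic and has some continuation, so
      both bits have followed it and a second escape is impossible.\<close>
    let ?k = "Suc i"
    have k: "?k \<le> j" "?k \<le> length x" using \<open>i < j\<close> j by auto
    then have "0 < esc x (drop ?k x)" "esc x (drop ?k x) \<noteq> 1"
      using esc_pos[of ?k] nd[of ?k] by (auto simp: deterministic_def)
    then have fb: "0 < cnt x (drop ?k x) b" by (cases b) (auto simp: esc_eq split: if_splits)
    have "code_prob x b (ctx_chain x) = real (esc x (drop i x)) / real (?T i + esc x (drop i x)) *
        (real (cnt x (drop ?k x) b) / real (?T ?k + esc x (drop ?k x)))"
      using False fb k(2) esc_pos[of i] ij
      by (simp add: chain Let_def upt_conv_Cons[of "Suc i"] del: upt_Suc)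
    moreover have "1 / real (N + 2) \<le> real (esc x (drop i x)) / real (?T i + esc x (drop i x))"
      using hit[of i "esc x (drop i x)"] esc_pos[of i] ij by simp
    moreover have "1 / real (N + 2) \<le> real (cnt x (drop ?k x) b) / real (?T ?k + esc x (drop ?k x))"
      using hit[of ?k, OF k(1) fb] esc_pos[of ?k] k by simp
    ultimately show ?thesis unfolding sq by (simp only:) (rule mult_mono; simp)
  qed
qed

definition cost :: "nat \<Rightarrow> real" where
  "cost t = - log 2 (code_prob (prefix_of seq t) (seq t) (ctx_chain (prefix_of seq t)))"

lemma cost_nonneg: "0 \<le> cost t"
  using code_prob_pos code_prob_le_1 by (simp add: cost_def)

lemma take_prefix_of: "i \<le> m \<Longrightarrow> take i (prefix_of S m) = prefix_of S i"
  by (simp add: prefix_of_def take_map)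

lemma ppm_len_le: "real (ppm_len (prefix_of seq m)) \<le> (\<Sum>t<m. cost t) + 1"
proof -
  have "ppm_prob (prefix_of seq m) =
      (\<Prod>t<m. code_prob (prefix_of seq t) (seq t) (ctx_chain (prefix_of seq t)))"
    unfolding ppm_prob_def by (rule prod.cong) (simp_all add: take_prefix_of, simp add: prefix_of_def)
  then have "log 2 (ppm_prob (prefix_of seq m)) = (\<Sum>t<m. log 2 (code_prob (prefix_of seq t) (seq t) (ctx_chain (prefix_of seq t))))"
    unfolding log_def sum_divide_distrib[symmetric]
    by (simp only:, subst ln_prod) (simp_all add: code_prob_pos)
  then have "- log 2 (ppm_prob (prefix_of seq m)) = (\<Sum>t<m. cost t)"
    by (simp add: cost_def sum_negf)
  moreover have "0 \<le> (\<Sum>t<m. cost t)" by (intro sum_nonneg cost_nonneg)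
  ultimately show ?thesis unfolding ppm_len_def by linarith
qed

section \<open>Repeated and conflicting contexts\<close>

lemma factor_Suc: "factor f i (Suc l) = factor f i l @ [f (i + l)]"
  by (simp add: factor_def)

lemma drop_prefix_of: "drop i (prefix_of S t) = factor S i (t - i)"
  by (cases "i \<le> t") (simp_all add: prefix_of_def factor_def drop_map)

lemma cnt_prefix_of:
  "cnt (prefix_of S t) c b = card {i. i + length c < t \<and> factor S i (length c) = c \<and> S (i + length c) = b}"
  unfolding cnt_def occ_prefix_of by (intro arg_cong[of _ _ card]) (auto simp: factor_Suc Suc_le_eq)

lemma cnt_prefix_of_pos_iff:
  "0 < cnt (prefix_of S t) c b \<longleftrightarrow> (\<exists>i. i + length c < t \<and> factor S i (length c) = c \<and> S (i + length c) = b)"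
proof -
  have "finite {i. i + length c < t \<and> factor S i (length c) = c \<and> S (i + length c) = b}"
    by (rule finite_subset[of _ "{..<t}"]) auto
  then show ?thesis by (auto simp: cnt_prefix_of card_gt_0_iff)
qed

text \<open>Block \<open>Suc (length c)\<close> lists \<open>c @ [b]\<close> as one of its words,
  and this block ends before \<open>t\<close>.\<close>

lemma cnt_pos_if_short:
  assumes "start (length c + 2) \<le> t"
  shows "0 < cnt (prefix_of seq t) c b"
proof -
  let ?k = "Suc (length c)"
  have "c @ [b] \<in> phrase ?k ` {..<2 ^ ?k}" unfolding image_phrase by simp
  then obtain a where a: "a < 2 ^ ?k" "phrase ?k a = c @ [b]" by auto
  let ?i = "start ?k + a * ?k"
  have "?i + length c < start (Suc ?k)" using phrase_less[OF a(1), of "length c"] by simp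
  then have "?i + length c < t" using assms by simp
  moreover have "factor seq ?i (length c) = c" "seq (?i + length c) = b"
    using a(2) by (auto simp: phrase_def factor_Suc)
  ultimately show ?thesis unfolding cnt_prefix_of_pos_iff by blast
qed

lemma stored_if_short:
  assumes "start (length c + 2) \<le> t"
  shows "stored (prefix_of seq t) c"
proof (cases "c = []")
  case False
  then have "Suc (length (butlast c)) = length c" by simp
  then have "start (length (butlast c) + 2) \<le> t"
    using assms mono_start[of "length (butlast c) + 2" "length c + 2"] by linarith
  then have "0 < cnt (prefix_of seq t) (butlast c) b" for b by (rule cnt_pos_if_short)
  from this[of False] this[of True] have "2 \<le> occ (butlast c) (prefix_of seq t)"
    using cnt_le_occ[of "prefix_of seq t" "butlast c"] by linarith
  moreover have "0 < occ (c @ [True]) (prefix_of seq t)"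
    using cnt_pos_if_short[OF assms, of True] by (simp add: cnt_def)
  ultimately show ?thesis by (auto simp: stored_def)
qed (simp add: stored_def)

text \<open>In a rotation of order \<open>k \<le> n\<close>, the first \<open>k\<close> letters of a
  window fix its offset, so at most one window inside the rotation equals \<open>c\<close>. Adding
  all \<open>n\<close> last offsets gives \<open>Suc n\<close> for each of at most
  \<open>Suc n * Suc n\<close> rotations.\<close>

lemma card_factor_seq:
  assumes "length c = n"
  shows "card {t. t < start (Suc n) \<and> factor seq t n = c} \<le> Suc n ^ 3"
proof -
  have "card {i. i < 2 ^ k \<and> factor seq (pos k \<rho> i) n = c} \<le> Suc n" if "k < Suc n" "\<rho> < k" for k \<rho>
  proof -
    let ?A = "{i. i + n \<le> 2 ^ k \<and> factor seq (pos k \<rho> i) n = c}"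
    have fin: "finite ?A" by (rule finite_subset[of _ "{..2 ^ k}"]) auto
    have "i = j" if "i \<in> ?A" "j \<in> ?A" for i j
    proof -
      have "factor (db k) (i + rot k \<rho>) n = factor (db k) (j + rot k \<rho>) n"
        using that factor_seq_pos[OF \<open>\<rho> < k\<close>, of _ n] by auto
      then have "factor (db k) (i + rot k \<rho>) k = factor (db k) (j + rot k \<rho>) k"
        using \<open>k < Suc n\<close> by (simp add: factor_eq_iff)
      moreover have "i < 2 ^ k" "j < 2 ^ k" using \<open>\<rho> < k\<close> \<open>k < Suc n\<close> that by auto
      ultimately show "i = j" using inj_onD[OF inj_on_factor_db] by blast
    qed
    then have "card ?A \<le> 1" using fin by (auto simp: card_le_Suc0_iff_eq)
    moreover have "card {2 ^ k - n..<2 ^ k} \<le> n" by simp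
    moreover have "card {i. i < 2 ^ k \<and> factor seq (pos k \<rho> i) n = c} \<le> card (?A \<union> {2 ^ k - n..<2 ^ k})"
      using fin by (intro card_mono) auto
    ultimately show ?thesis using card_Un_le[of ?A "{2 ^ k - n..<2 ^ k}"] by linarith
  qed
  then have "card {t. t < start (Suc n) \<and> factor seq t n = c} \<le> Suc n * Suc n * Suc n"
    by (rule card_start_le)
  then show ?thesis by (simp only: power3_eq_cube)
qed

text \<open>Each occurrence extends by two letters to a window of length \<open>n\<close>, and there
  are four such extensions.\<close>

lemma occ_short_le:
  assumes "length c + 2 = n" "t < start (Suc n)"
  shows "occ c (prefix_of seq t) \<le> 4 * Suc n ^ 3"
proof -
  let ?A = "\<lambda>v. {i. i < start (Suc n) \<and> factor seq i n = c @ v}"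
  let ?V = "{v :: bool list. length v = 2}"
  have "{i. i + length c \<le> t \<and> factor seq i (length c) = c} \<subseteq> (\<Union>v\<in>?V. ?A v)"
  proof
    fix i assume i: "i \<in> {i. i + length c \<le> t \<and> factor seq i (length c) = c}"
    have "factor seq i n = factor seq i (length c) @ factor seq (i + length c) 2"
      unfolding assms(1)[symmetric] by (rule factor_add)
    then show "i \<in> (\<Union>v\<in>?V. ?A v)" using i assms(2) by (intro UN_I[of "factor seq (i + length c) 2"]) auto
  qed
  then have "occ c (prefix_of seq t) \<le> card (\<Union>v\<in>?V. ?A v)"
    unfolding occ_prefix_of by (rule card_mono[rotated]) (simp add: finite_words)
  also have "\<dots> \<le> (\<Sum>v\<in>?V. card (?A v))" by (rule card_UN_le[OF finite_words])
  also have "\<dots> \<le> (\<Sum>v\<in>?V. Suc n ^ 3)"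
    using assms(1) by (intro sum_mono card_factor_seq) auto
  finally show ?thesis by (simp add: card_words)
qed

definition max_cost :: "nat \<Rightarrow> real" where
  "max_cost n = 2 * log 2 (4 * (real n + 1) ^ 3 + 2)"

text \<open>Contexts of length \<open>n - 2\<close> are a compromise: block \<open>n - 1\<close> has
  shown them with both continuations, yet they have occurred only polynomially often.\<close>

lemma cost_le_max_cost:
  assumes "2 \<le> n" "start n \<le> t" "t < start (Suc n)"
  shows "cost t \<le> max_cost n"
proof -
  let ?x = "prefix_of seq t"
  obtain m where m: "n = m + 2" using assms(1) by (metis add.commute le_Suc_ex)
  have "m \<le> start (m + 2)" using le_start[of "Suc m"] by simp
  then have mt: "m \<le> t" using assms(2) m by simp
  define c where "c = drop (t - m) ?x"
  have len: "length c = m" using mt by (simp add: c_def)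
  have st: "start (length c + 2) \<le> t" using assms(2) by (simp only: len m)
  define N where "N = 4 * Suc n ^ 3"
  have "1 / real (N + 2) ^ 2 \<le> code_prob ?x (seq t) (ctx_chain ?x)"
  proof (rule code_prob_general[of "t - m"], unfold c_def[symmetric])
    show "stored ?x c" by (rule stored_if_short[OF st])
    show "0 < cnt ?x c b" for b by (rule cnt_pos_if_short[OF st])
    show "cnt ?x c False + cnt ?x c True \<le> N"
      unfolding N_def using cnt_le_occ[of ?x c] occ_short_le[of c n t] len m assms(3) by linarith
  qed simp
  then have "log 2 (1 / real (N + 2) ^ 2) \<le> log 2 (code_prob ?x (seq t) (ctx_chain ?x))"
    by (rule log_mono[rotated 2]) simp_all
  moreover have "log 2 (1 / real (N + 2) ^ 2) = - (2 * log 2 (real (N + 2)))"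
    by (subst log_divide) (simp_all add: log_nat_power del: of_nat_add)
  moreover have "max_cost n = 2 * log 2 (real (N + 2))" by (simp add: max_cost_def N_def add.commute)
  ultimately show ?thesis unfolding cost_def by linarith
qed

text \<open>Applied only with \<open>L \<le> t\<close>, where \<open>t - L\<close> is not
  truncated.\<close>

definition conflict :: "nat \<Rightarrow> nat \<Rightarrow> bool" where
  "conflict L t \<longleftrightarrow> (\<exists>s. s + L < t \<and> factor seq s L = factor seq (t - L) L \<and> seq (s + L) \<noteq> seq t)"

lemma pos_less_pos:
  assumes "\<rho>' < \<rho>" "i' < 2 ^ n"
  shows "pos n \<rho>' i' < pos n \<rho> i"
proof -
  have "\<rho>' * 2 ^ n + i' < Suc \<rho>' * 2 ^ n" using assms(2) by simp
  also have "\<dots> \<le> \<rho> * 2 ^ n" using assms(1) by (intro mult_right_mono) auto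
  finally show ?thesis by (simp add: pos_def)
qed

text \<open>Each of the \<open>\<rho>\<close> earlier rotations of the block shows the same
  \<open>L\<close> bits with the same next bit. Without a conflict the context is therefore
  deterministic with count at least \<open>\<rho>\<close>; \<open>2 \<le> \<rho>\<close> supplies
  the two occurrences needed for it to be stored.\<close>

lemma cost_le_no_conflict:
  assumes \<rho>: "2 \<le> \<rho>" "\<rho> < n" and i: "L \<le> i" "i + n < 2 ^ n" and L: "0 < L"
    and nc: "\<not> conflict L (pos n \<rho> i)"
  shows "cost (pos n \<rho> i) \<le> log 2 (real (Suc \<rho>)) - log 2 (real \<rho>)"
proof -
  let ?t = "pos n \<rho> i"
  let ?x = "prefix_of seq ?t"
  define c where "c = drop (?t - L) ?x"
  have Lt: "L \<le> ?t" using i by (simp add: pos_def)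
  have c: "c = factor seq (?t - L) L" unfolding c_def drop_prefix_of using Lt by simp
  then have len: "length c = L" by simp
  have tL: "?t - L = pos n \<rho> (i - L)" using i by (simp add: pos_def)
  \<comment> \<open>The offset in rotation \<open>\<rho>'\<close> with the phase of offset
    \<open>i\<close> in rotation \<open>\<rho>\<close>. Shifts differ by less than \<open>n\<close>,
    so \<open>i + n < 2 ^ n\<close> keeps it inside the rotation.\<close>
  define e where "e \<rho>' = i + rot n \<rho> - rot n \<rho>'" for \<rho>'
  have rot: "rot n \<rho>' \<le> rot n \<rho>" "rot n \<rho> < n" if "\<rho>' < \<rho>" for \<rho>'
    using rot_mono[of \<rho>' \<rho> n] rot_le[of n \<rho>] that \<rho> by auto
  have e: "e \<rho>' < 2 ^ n" "L \<le> e \<rho>'" "e \<rho>' + rot n \<rho>' = i + rot n \<rho>" if "\<rho>' < \<rho>" for \<rho>'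
    using rot[OF that] i unfolding e_def by linarith+
  define s where "s \<rho>' = pos n \<rho>' (e \<rho>' - L)" for \<rho>'
  have sL: "s \<rho>' + L = pos n \<rho>' (e \<rho>')" if "\<rho>' < \<rho>" for \<rho>'
    using e[OF that] by (simp add: s_def pos_def)
  have "\<rho> \<le> cnt ?x c (seq ?t)"
  proof -
    let ?A = "{i. i + length c < ?t \<and> factor seq i (length c) = c \<and> seq (i + length c) = seq ?t}"
    have "s \<rho>' \<in> ?A" if "\<rho>' < \<rho>" for \<rho>'
    proof -
      have "s \<rho>' + L < ?t" unfolding sL[OF that] using that e[OF that] by (intro pos_less_pos)
      moreover have "factor seq (s \<rho>') L = factor (db n) (e \<rho>' - L + rot n \<rho>') L"
        unfolding s_def using e[OF that] that \<rho> by (intro factor_seq_pos) auto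
      then have "factor seq (s \<rho>') L = factor (db n) (i - L + rot n \<rho>) L"
        using e[OF that] i by (metis Nat.add_diff_assoc2)
      moreover have "c = factor (db n) (i - L + rot n \<rho>) L"
        unfolding c tL using i \<rho> by (intro factor_seq_pos) auto
      moreover have "seq (s \<rho>' + L) = seq ?t"
        unfolding sL[OF that] using that \<rho> i e[OF that] by (simp add: seq_pos)
      ultimately show ?thesis by (simp add: len)
    qed
    moreover have "inj_on s {..<\<rho>}"
    proof (rule linorder_inj_onI')
      fix a b assume ab: "a \<in> {..<\<rho>}" "b \<in> {..<\<rho>}" "a < b"
      have "e a - L < 2 ^ n" using e[of a] ab by simp
      then show "s a \<noteq> s b" using pos_less_pos[OF ab(3), of "e a - L" n "e b - L"] by (simp add: s_def)
    qed
    moreover have "finite ?A" by (rule finite_subset[of _ "{..<?t}"]) auto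
    ultimately have "card {..<\<rho>} \<le> card ?A" by (intro card_inj_on_le[of s]) auto
    then show ?thesis by (simp add: cnt_prefix_of)
  qed
  moreover have "cnt ?x c (\<not> seq ?t) = 0"
  proof (rule ccontr)
    assume "cnt ?x c (\<not> seq ?t) \<noteq> 0"
    then obtain s where "s + L < ?t" "factor seq s L = c" "seq (s + L) = (\<not> seq ?t)"
      using cnt_prefix_of_pos_iff[of seq ?t c "\<not> seq ?t"] len by auto
    then show False using nc c unfolding conflict_def by blast
  qed
  ultimately have det: "deterministic ?x c" and pos: "0 < cnt ?x c (seq ?t)"
    using \<rho> by (cases "seq ?t"; simp add: deterministic_def esc_eq)+
  have "c \<noteq> []" using len L by auto
  then have "occ c ?x \<le> occ (butlast c) ?x"
    using occ_append_le_left[of "butlast c" "[last c]" ?x] by simp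
  moreover have "cnt ?x c (seq ?t) \<le> occ c ?x"
    unfolding cnt_def by (rule occ_append_le_left)
  ultimately have "stored ?x c"
    using \<open>\<rho> \<le> cnt ?x c (seq ?t)\<close> \<rho> pos by (auto simp: stored_def cnt_def)
  then have "real \<rho> / real (Suc \<rho>) \<le> code_prob ?x (seq ?t) (ctx_chain ?x)"
    using det \<open>\<rho> \<le> cnt ?x c (seq ?t)\<close> \<rho> unfolding c_def
    by (intro code_prob_deterministic[of "?t - L"]) auto
  then have "log 2 (real \<rho> / real (Suc \<rho>)) \<le> log 2 (code_prob ?x (seq ?t) (ctx_chain ?x))"
    using code_prob_pos \<rho> by (subst log_le_cancel_iff) auto
  then show ?thesis using \<rho> unfolding cost_def by (simp add: log_divide del: of_nat_Suc)
qed

text \<open>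
  Each \<open>p \<in> A\<close> starts a common factor that is broken after \<open>2 n\<close> letters. The \<open>n + 1\<close> windows of
  length \<open>n\<close> in it have pairwise distinct phases modulo \<open>2 ^ k\<close>, also for distinct \<open>p\<close>: equal phases
  would align the two common factors, and the one reaching further would continue past the mismatch of
  the other.
\<close>

lemma card_mismatch_le:
  assumes inj: "inj_on (\<lambda>p. p mod 2 ^ n) A" and fin: "finite A"
    and ex: "\<And>p. p \<in> A \<Longrightarrow> \<exists>q. factor (db k) q (2 * n) = factor (db n) p (2 * n) \<and> db k (q + 2 * n) \<noteq> db n (p + 2 * n)"
  shows "Suc n * card A \<le> 2 ^ k"
proof -
  obtain q where q: "\<And>p j. p \<in> A \<Longrightarrow> j < 2 * n \<Longrightarrow> db k (q p + j) = db n (p + j)"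
    and neq: "\<And>p. p \<in> A \<Longrightarrow> db k (q p + 2 * n) \<noteq> db n (p + 2 * n)"
    using ex unfolding factor_eq_iff by metis
  define h where "h = (\<lambda>(p, e). (q p + e) mod 2 ^ k)"
  have cong: "(p1 + e1) mod 2 ^ n = (p2 + e2) mod 2 ^ n"
    if pe: "p1 \<in> A" "p2 \<in> A" "e1 \<le> n" "e2 \<le> n" "(q p1 + e1) mod 2 ^ k = (q p2 + e2) mod 2 ^ k" for p1 p2 e1 e2
  proof -
    have "db n (p1 + e1 + j) = db n (p2 + e2 + j)" if j: "j < n" for j
      using q[of p1 "e1 + j"] q[of p2 "e2 + j"] db_add_cong[OF pe(5), of j] pe(1-4) j
      by (simp add: add.assoc)
    then show ?thesis by (simp add: factor_eq_iff flip: factor_db_eq_iff)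
  qed
  have nless: "\<not> e2 < e1"
    if pe: "p1 \<in> A" "p2 \<in> A" "e1 \<le> n" "e2 \<le> n" "(q p1 + e1) mod 2 ^ k = (q p2 + e2) mod 2 ^ k" for p1 p2 e1 e2
  proof
    assume less: "e2 < e1"
    \<comment> \<open>After \<open>?j\<close> letters the first factor is at its mismatch, while
      \<open>e2 + ?j < 2 * n\<close> leaves the second inside its match.\<close>
    let ?j = "2 * n - e1"
    have "db k (q p1 + 2 * n) = db k (q p2 + (e2 + ?j))"
      using db_add_cong[OF pe(5), of ?j] pe(3) by (simp add: add.assoc)
    also have "\<dots> = db n (p2 + (e2 + ?j))" using less pe by (intro q) auto
    also have "\<dots> = db n (p1 + 2 * n)"
      using db_add_cong[OF cong[OF pe], of ?j] pe(3) by (simp add: add.assoc)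
    finally show False using neq[OF pe(1)] by simp
  qed
  have "inj_on h (A \<times> {..n})"
  proof (rule inj_onI)
    fix x y assume xy: "x \<in> A \<times> {..n}" "y \<in> A \<times> {..n}" "h x = h y"
    obtain p1 e1 p2 e2 where [simp]: "x = (p1, e1)" "y = (p2, e2)" by fastforce
    have pe: "p1 \<in> A" "p2 \<in> A" "e1 \<in> {..n}" "e2 \<in> {..n}" "h (p1, e1) = h (p2, e2)"
      using xy by auto
    then have eq: "e1 = e2" using nless[of p1 p2 e1 e2] nless[of p2 p1 e2 e1] by (auto simp: h_def)
    then have "[p1 + e1 = p2 + e1] (mod 2 ^ n)" using cong[of p1 p2 e1 e1] pe by (simp add: h_def cong_def)
    then have "p1 mod 2 ^ n = p2 mod 2 ^ n" by (simp add: cong_add_rcancel_nat cong_def[symmetric])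
    then show "x = y" using inj pe eq by (auto dest: inj_onD)
  qed
  moreover have "h ` (A \<times> {..n}) \<subseteq> {..<2 ^ k}" by (auto simp: h_def)
  ultimately have "card (A \<times> {..n}) \<le> card {..<(2 :: nat) ^ k}" by (intro card_inj_on_le) auto
  then show ?thesis by (simp add: card_cartesian_product mult.commute)
qed

text \<open>Conflicts are sorted by their earlier occurrence \<open>s i\<close>. If it is not
  \<open>inner\<close>, it starts at one of the last \<open>2 * n\<close> offsets of a rotation,
  which gives the polynomial term. If it lies with its continuation inside a rotation of order
  \<open>k\<close>, then \<open>card_mismatch_le\<close> applies, and the bounds
  \<open>2 ^ k\<close> for \<open>k < n\<close> sum to at most \<open>2 ^ n\<close>.\<close>

lemma card_conflict_le:
  assumes "\<rho> < n"
  defines "A \<equiv> {i. 2 * n \<le> i \<and> i < 2 ^ n \<and> conflict (2 * n) (pos n \<rho> i)}"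
  shows "Suc n * card A \<le> 2 ^ n + Suc n * (Suc n * Suc n * (2 * n))"
proof -
  let ?L = "2 * n"
  let ?p = "\<lambda>i. i - ?L + rot n \<rho>"
  have finA: "finite A" unfolding A_def by (rule finite_subset[of _ "{..<2 ^ n}"]) auto
  define inner where "inner k s \<longleftrightarrow> (\<exists>\<rho>'<k. \<exists>u. u + ?L < 2 ^ k \<and> s = pos k \<rho>' u)" for k s
  have "\<forall>i\<in>A. \<exists>s. s + ?L < pos n \<rho> i \<and> factor seq s ?L = factor seq (pos n \<rho> i - ?L) ?L \<and> seq (s + ?L) \<noteq> seq (pos n \<rho> i)"
    by (simp add: A_def conflict_def)
  then obtain s where s: "\<And>i. i \<in> A \<Longrightarrow> s i + ?L < pos n \<rho> i"
    and fac: "\<And>i. i \<in> A \<Longrightarrow> factor seq (s i) ?L = factor seq (pos n \<rho> i - ?L) ?L"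
    and neq: "\<And>i. i \<in> A \<Longrightarrow> seq (s i + ?L) \<noteq> seq (pos n \<rho> i)" by metis
  have fac': "factor seq (s i) ?L = factor (db n) (?p i) ?L" if "i \<in> A" for i
  proof -
    have "pos n \<rho> i - ?L = pos n \<rho> (i - ?L)" using that by (simp add: A_def pos_def)
    then show ?thesis using fac[OF that] factor_seq_pos[OF assms(1), of "i - ?L" ?L] that by (simp add: A_def)
  qed
  have at: "seq (pos n \<rho> i) = db n (?p i + ?L)" if "i \<in> A" for i
    using seq_pos[OF assms(1), of i] that by (simp add: A_def)
  have injp: "inj_on ?p A" unfolding A_def by (auto simp: inj_on_def)
  have "inj_on (\<lambda>i. ?p i mod 2 ^ n) A"
  proof (rule inj_onI)
    fix i j assume ij: "i \<in> A" "j \<in> A" "?p i mod 2 ^ n = ?p j mod 2 ^ n"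
    then have "[i - ?L = j - ?L] (mod 2 ^ n)" by (simp add: cong_add_rcancel_nat flip: cong_def)
    then have "i - ?L = j - ?L" using ij by (auto simp: A_def cong_def)
    then show "i = j" using ij by (auto simp: A_def)
  qed
  then have injmod: "inj_on (\<lambda>p. p mod 2 ^ n) (?p ` A)" by (simp add: inj_on_imageI o_def)
  \<comment> \<open>The word at \<open>s i\<close> contains a window of length \<open>n\<close> of
    \<open>db n\<close>, whose phase determines \<open>i\<close>.\<close>
  have inj_s: "inj_on s A"
  proof (rule inj_onI)
    fix i j assume ij: "i \<in> A" "j \<in> A" "s i = s j"
    then have "factor (db n) (?p i) ?L = factor (db n) (?p j) ?L" using fac' by metis
    then have "factor (db n) (?p i) n = factor (db n) (?p j) n" by (simp add: factor_eq_iff)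
    then show "i = j" using ij \<open>inj_on (\<lambda>i. ?p i mod 2 ^ n) A\<close>
      by (auto simp: factor_db_eq_iff dest: inj_onD)
  qed
  define A1 where "A1 = {i \<in> A. \<not> (\<exists>k. inner k (s i))}"
  define A2 where "A2 k = {i \<in> A. inner k (s i)}" for k
  have s_less: "s i < start (Suc n)" if "i \<in> A" for i
    using s[OF that] pos_less_start[OF assms(1), of i] that by (simp add: A_def)
  have "A1 \<subseteq> A" "\<And>k. A2 k \<subseteq> A" by (auto simp: A1_def A2_def)
  have "card A1 \<le> card {t. t < start (Suc n) \<and> \<not> (\<exists>k. inner k t)}"
    using s_less \<open>A1 \<subseteq> A\<close> by (intro card_inj_on_le[of s] inj_on_subset[OF inj_s]) (auto simp: A1_def)
  also have "\<dots> \<le> Suc n * Suc n * ?L"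
  proof (rule card_start_le)
    fix k \<rho>' assume "k < Suc n" "\<rho>' < k"
    then have "{i. i < 2 ^ k \<and> \<not> (\<exists>k'. inner k' (pos k \<rho>' i))} \<subseteq> {2 ^ k - ?L..<2 ^ k}"
      by (force simp: inner_def)
    then have "card {i. i < 2 ^ k \<and> \<not> (\<exists>k'. inner k' (pos k \<rho>' i))} \<le> card {2 ^ k - ?L..<2 ^ k}"
      by (intro card_mono) auto
    then show "card {i. i < 2 ^ k \<and> \<not> (\<exists>k'. inner k' (pos k \<rho>' i))} \<le> ?L" by simp
  qed
  finally have A1: "card A1 \<le> Suc n * Suc n * ?L" .
  have match: "\<exists>q. factor (db k) q ?L = factor (db n) (?p i) ?L \<and> db k (q + ?L) \<noteq> db n (?p i + ?L)"
    if "i \<in> A2 k" for i k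
  proof -
    from that obtain \<rho>' u where i: "i \<in> A" and u: "\<rho>' < k" "u + ?L < 2 ^ k" "s i = pos k \<rho>' u"
      by (auto simp: A2_def inner_def)
    have "s i + ?L = pos k \<rho>' (u + ?L)" using u by (simp add: pos_def)
    then have "seq (s i + ?L) = db k (u + rot k \<rho>' + ?L)" using seq_pos[OF u(1,2)] by (simp add: ac_simps)
    moreover have "factor seq (s i) ?L = factor (db k) (u + rot k \<rho>') ?L"
      unfolding u(3) using u by (intro factor_seq_pos) auto
    ultimately show ?thesis using fac'[OF i] neq[OF i] at[OF i] by (intro exI[of _ "u + rot k \<rho>'"]) auto
  qed
  have A2: "Suc n * card (A2 k) \<le> 2 ^ k" for k
  proof -
    have "finite (?p ` A2 k)" using finite_subset[OF \<open>A2 k \<subseteq> A\<close> finA] by simp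
    moreover have "inj_on (\<lambda>p. p mod 2 ^ n) (?p ` A2 k)"
      using \<open>A2 k \<subseteq> A\<close> by (intro inj_on_subset[OF injmod] image_mono)
    ultimately have "Suc n * card (?p ` A2 k) \<le> 2 ^ k" using match by (intro card_mismatch_le) auto
    moreover have "card (?p ` A2 k) = card (A2 k)"
      using \<open>A2 k \<subseteq> A\<close> by (intro card_image inj_on_subset[OF injp])
    ultimately show ?thesis by simp
  qed
  have level_less_n: "k < n" if i: "i \<in> A2 k" for i k
  proof -
    have iA: "i \<in> A" using i by (simp add: A2_def)
    have "start k \<le> s i" using i by (auto simp: A2_def inner_def pos_def)
    then have "\<not> Suc n \<le> k" using s_less[OF iA] mono_start[of "Suc n" k] by linarith
    \<comment> \<open>Within order \<open>n\<close> equal windows have equal phases, so their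
      continuations cannot differ.\<close>
    moreover have "k \<noteq> n"
    proof
      assume "k = n"
      with match[OF i] obtain q where q: "factor (db n) q ?L = factor (db n) (?p i) ?L"
        "db n (q + ?L) \<noteq> db n (?p i + ?L)" by blast
      have "factor (db n) q n = factor (db n) (?p i) n" using q(1) by (simp add: factor_eq_iff)
      then have "q mod 2 ^ n = ?p i mod 2 ^ n" by (simp only: factor_db_eq_iff)
      then show False using q(2) db_add_cong by blast
    qed
    ultimately show ?thesis by simp
  qed
  have "A \<subseteq> A1 \<union> (\<Union>k<n. A2 k)" using level_less_n by (auto simp: A1_def A2_def)
  moreover have "finite A1" "finite (\<Union>k<n. A2 k)"
    using finA \<open>A1 \<subseteq> A\<close> \<open>\<And>k. A2 k \<subseteq> A\<close> by (auto intro: finite_subset)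
  ultimately have "card A \<le> card (A1 \<union> (\<Union>k<n. A2 k))" by (intro card_mono) auto
  also have "\<dots> \<le> card A1 + card (\<Union>k<n. A2 k)" by (rule card_Un_le)
  also have "card (\<Union>k<n. A2 k) \<le> (\<Sum>k<n. card (A2 k))" by (rule card_UN_le) simp
  finally have "Suc n * card A \<le> Suc n * (card A1 + (\<Sum>k<n. card (A2 k)))" by (simp only: mult_le_mono2 add_le_cancel_left)
  also have "\<dots> = Suc n * card A1 + (\<Sum>k<n. Suc n * card (A2 k))"
    by (simp only: distrib_left sum_distrib_left)
  also have "\<dots> \<le> Suc n * (Suc n * Suc n * ?L) + (\<Sum>k<n. 2 ^ k)"
    by (intro add_mono mult_le_mono2 A1 sum_mono A2)
  also have "(\<Sum>k<n. 2 ^ k) \<le> (2 :: nat) ^ n" by (induction n) auto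
  finally show ?thesis by simp
qed

section \<open>Summing the costs over rotations and blocks\<close>

lemma max_cost_nonneg: "0 \<le> max_cost n"
proof -
  have "(0 :: real) \<le> 4 * (real n + 1) ^ 3" by simp
  then have "(1 :: real) \<le> 4 * (real n + 1) ^ 3 + 2" by linarith
  then have "0 \<le> log 2 (4 * (real n + 1) ^ 3 + 2)" by (subst zero_le_log_cancel_iff) linarith+
  then show ?thesis unfolding max_cost_def by simp
qed

lemma max_cost_mono: "k \<le> n \<Longrightarrow> max_cost k \<le> max_cost n"
  unfolding max_cost_def by (intro mult_left_mono log_mono add_mono mult_left_mono power_mono) (auto intro: add_nonneg_pos)

lemma pos_ge: "start n \<le> pos n \<rho> i"
  by (simp add: pos_def)

text \<open>Bounds the offsets of a rotation that are charged \<open>max_cost n\<close>: the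
  conflicts from \<open>card_conflict_le\<close>, divided by \<open>Suc n\<close>, and
  \<open>3 * n\<close> offsets near the seams.\<close>

definition bad_bound :: "nat \<Rightarrow> real" where
  "bad_bound n = 2 ^ n / (real n + 1) + (real n + 1) ^ 2 * (2 * real n) + 3 * real n"

text \<open>For \<open>\<rho> = 0\<close> the difference of logarithms is \<open>0\<close> because \<open>log 2 0 = 0\<close>.\<close>

lemma cost_piece:
  assumes \<rho>: "\<rho> < n" and n: "2 \<le> n"
  shows "(\<Sum>i<2 ^ n. cost (pos n \<rho> i)) \<le>
    2 ^ n * (log 2 (real (Suc \<rho>)) - log 2 (real \<rho>)) + max_cost n * (if \<rho> < 2 then 2 ^ n else bad_bound n)"
proof -
  let ?w = "max_cost n" and ?g = "log 2 (real (Suc \<rho>)) - log 2 (real \<rho>)"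
  have g: "0 \<le> ?g" by (cases "\<rho> = 0") (simp add: log_def, simp del: of_nat_Suc)
  have le_w: "cost (pos n \<rho> i) \<le> ?w" if "i < 2 ^ n" for i
    using cost_le_max_cost[OF n pos_ge pos_less_start[OF \<rho> that]] .
  show ?thesis
  proof (cases "\<rho> < 2")
    case True
    have "(\<Sum>i<2 ^ n. cost (pos n \<rho> i)) \<le> (\<Sum>i<(2::nat) ^ n. ?w)" using le_w by (intro sum_mono) auto
    moreover have "0 \<le> 2 ^ n * ?g" using g by simp
    ultimately show ?thesis using True by (simp add: mult.commute)
  next
    case False
    define A where "A = {i. 2 * n \<le> i \<and> i < 2 ^ n \<and> conflict (2 * n) (pos n \<rho> i)}"
    \<comment> \<open>Besides conflicts: the first \<open>2 * n\<close> offsets, where the context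
      would cross the seam, and the last \<open>n\<close>, where the shifted copy in an earlier
      rotation might.\<close>
    define Z where "Z = A \<union> {..<2 * n} \<union> {2 ^ n - n..<2 ^ n}"
    have finA: "finite A" unfolding A_def by (rule finite_subset[of _ "{..<2 ^ n}"]) auto
    have "card Z \<le> card A + card {..<2 * n} + card {2 ^ n - n..<2 ^ n}"
      unfolding Z_def by (intro order_trans[OF card_Un_le] add_mono card_Un_le order_refl)
    also have "\<dots> \<le> card A + 3 * n" by simp
    finally have Z: "real (card Z) \<le> real (card A) + 3 * real n" by linarith
    have "real (Suc n * card A) \<le> real (2 ^ n + Suc n * (Suc n * Suc n * (2 * n)))"
      using card_conflict_le[OF \<rho>] unfolding A_def by (intro of_nat_mono)
    then have "(real n + 1) * real (card A) \<le> 2 ^ n + (real n + 1) * ((real n + 1) ^ 2 * (2 * real n))"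
      by (simp add: power2_eq_square algebra_simps)
    then have "real (card A) \<le> 2 ^ n / (real n + 1) + (real n + 1) ^ 2 * (2 * real n)"
      by (simp add: field_simps)
    with Z have Z: "real (card Z) \<le> bad_bound n" unfolding bad_bound_def by linarith
    have "cost (pos n \<rho> i) \<le> ?g + ?w * of_bool (i \<in> Z)" if i: "i < 2 ^ n" for i
    proof (cases "i \<in> Z")
      case True
      then show ?thesis using le_w[OF i] g by simp
    next
      case nZ: False
      then have "cost (pos n \<rho> i) \<le> ?g"
        using i False \<rho> n by (intro cost_le_no_conflict[of \<rho> n "2 * n"]) (auto simp: Z_def A_def)
      then show ?thesis using nZ by simp
    qed
    then have "(\<Sum>i<2 ^ n. cost (pos n \<rho> i)) \<le> (\<Sum>i<2 ^ n. ?g + ?w * of_bool (i \<in> Z))"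
      by (intro sum_mono) auto
    also have "\<dots> = 2 ^ n * ?g + ?w * (\<Sum>i<2 ^ n. of_bool (i \<in> Z))"
      by (simp add: sum.distrib sum_distrib_left)
    also have "(\<Sum>i<(2::nat) ^ n. of_bool (i \<in> Z)) = real (card ({..<2 ^ n} \<inter> Z))"
      by (simp add: of_bool_def sum.If_cases)
    also have "\<dots> \<le> real (card Z)" using finA by (intro of_nat_mono card_mono) (auto simp: Z_def)
    also have "\<dots> \<le> bad_bound n" by (rule Z)
    finally show ?thesis using False max_cost_nonneg[of n] by (simp add: mult_left_mono)
  qed
qed

lemma bad_bound_nonneg: "0 \<le> bad_bound n"
  by (simp add: bad_bound_def)

text \<open>The differences of logarithms telescope over the rotations to \<open>log 2 n\<close>.
  Rotations \<open>0\<close> and \<open>1\<close> pay \<open>max_cost n\<close> for every bit, hence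
  the summand \<open>2 * max_cost n\<close>.\<close>

lemma cost_block:
  assumes "2 \<le> n"
  shows "(\<Sum>\<rho><n. \<Sum>i<2 ^ n. cost (pos n \<rho> i)) \<le>
    2 ^ n * (log 2 (real n) + 2 * max_cost n) + real n * max_cost n * bad_bound n"
proof -
  let ?w = "max_cost n"
  have "(\<Sum>\<rho><n. \<Sum>i<2 ^ n. cost (pos n \<rho> i)) \<le>
      (\<Sum>\<rho><n. 2 ^ n * (log 2 (real (Suc \<rho>)) - log 2 (real \<rho>)) + ?w * (if \<rho> < 2 then 2 ^ n else bad_bound n))"
    using assms by (intro sum_mono cost_piece) auto
  also have "\<dots> = 2 ^ n * log 2 (real n) + ?w * (\<Sum>\<rho><n. if \<rho> < 2 then 2 ^ n else bad_bound n)"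
    using sum_lessThan_telescope[of "\<lambda>\<rho>. log 2 (real \<rho>)" n]
    unfolding sum.distrib sum_distrib_left[symmetric] by (simp add: log_def del: of_nat_Suc)
  also have "\<dots> \<le> 2 ^ n * log 2 (real n) + ?w * (2 * 2 ^ n + real n * bad_bound n)"
  proof (intro add_left_mono mult_left_mono max_cost_nonneg)
    have "(\<Sum>\<rho><n. if \<rho> < 2 then 2 ^ n else bad_bound n) \<le> (\<Sum>\<rho><n. (if \<rho> < 2 then 2 ^ n else 0) + bad_bound n)"
      by (intro sum_mono) (simp add: bad_bound_nonneg)
    moreover have "{..<n} \<inter> {\<rho>. \<rho> < 2} = {..<2}" using assms by auto
    ultimately show "(\<Sum>\<rho><n. if \<rho> < 2 then 2 ^ n else bad_bound n) \<le> 2 * 2 ^ n + real n * bad_bound n"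
      by (simp add: sum.distrib sum.If_cases)
  qed
  finally show ?thesis by (simp add: algebra_simps)
qed

text \<open>Blocks \<open>0\<close> and \<open>1\<close>, to which \<open>cost_block\<close> does
  not apply, remain as a constant. In the others, \<open>k / (k + 1) \<le> 1\<close> turns the
  conflict term into a third \<open>max_cost\<close>, and the powers of \<open>2\<close> sum to at
  most \<open>2 * 2 ^ n\<close>.\<close>

lemma cost_start:
  assumes "2 \<le> n"
  shows "(\<Sum>t<start (Suc n). cost t) \<le> (\<Sum>t<start 2. cost t) +
    (2 * 2 ^ n * (log 2 (real n) + 3 * max_cost n) +
     real n * (real n * max_cost n * ((real n + 1) ^ 2 * (2 * real n) + 3 * real n)))"
proof -
  let ?w = "max_cost n" and ?P = "(real n + 1) ^ 2 * (2 * real n) + 3 * real n"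
  have block: "(\<Sum>\<rho><k. \<Sum>i<2 ^ k. cost (pos k \<rho> i)) \<le> 2 ^ k * (log 2 (real n) + 3 * ?w) + real n * ?w * ?P"
    if k: "2 \<le> k" "k \<le> n" for k
  proof -
    let ?Q = "(real k + 1) ^ 2 * (2 * real k) + 3 * real k"
    have "real k * max_cost k * bad_bound k = real k / (real k + 1) * (max_cost k * 2 ^ k) + real k * max_cost k * ?Q"
      by (simp add: bad_bound_def algebra_simps)
    also have "\<dots> \<le> 1 * (max_cost k * 2 ^ k) + real k * max_cost k * ?Q"
      using max_cost_nonneg[of k] by (intro add_right_mono mult_right_mono) (auto simp: divide_le_eq_1)
    finally have "2 ^ k * (log 2 (real k) + 2 * max_cost k) + real k * max_cost k * bad_bound k
        \<le> 2 ^ k * (log 2 (real k) + 3 * max_cost k) + real k * max_cost k * ?Q"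
      by (simp add: algebra_simps)
    also have "\<dots> \<le> 2 ^ k * (log 2 (real n) + 3 * ?w) + real n * ?w * ?P"
      using k max_cost_nonneg max_cost_mono[OF k(2)]
      by (intro add_mono mult_mono mult_left_mono power_mono mult_nonneg_nonneg order_refl) auto
    finally show ?thesis using cost_block[OF k(1)] by linarith
  qed
  have split: "(\<Sum>k<Suc n. h k) = (\<Sum>k<2. h k) + (\<Sum>k=2..n. h k)" for h :: "nat \<Rightarrow> real"
  proof -
    have "sum h {0..<2} + sum h {2..<Suc n} = sum h {0..<Suc n}"
      using assms by (intro sum.atLeastLessThan_concat) auto
    then show ?thesis unfolding atLeast0LessThan unfolding atLeastLessThanSuc_atLeastAtMost by (rule sym)
  qed
  have "(\<Sum>t<start (Suc n). cost t) = (\<Sum>t<start 2. cost t) + (\<Sum>k=2..n. \<Sum>\<rho><k. \<Sum>i<2 ^ k. cost (pos k \<rho> i))"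
    unfolding sum_start by (rule split)
  also have "(\<Sum>k=2..n. \<Sum>\<rho><k. \<Sum>i<2 ^ k. cost (pos k \<rho> i)) \<le>
      (\<Sum>k=2..n. 2 ^ k * (log 2 (real n) + 3 * ?w) + real n * ?w * ?P)"
    using block by (intro sum_mono) auto
  also have "\<dots> \<le> (\<Sum>k<Suc n. 2 ^ k * (log 2 (real n) + 3 * ?w)) + (\<Sum>k=2..n. real n * ?w * ?P)"
    using assms max_cost_nonneg[of n] unfolding sum.distrib
    by (intro add_right_mono sum_mono2) auto
  also have "\<dots> \<le> 2 * 2 ^ n * (log 2 (real n) + 3 * ?w) + real n * (real n * ?w * ?P)"
  proof (rule add_mono)
    have "(\<Sum>k<Suc n. 2 ^ k * (log 2 (real n) + 3 * ?w)) = (\<Sum>k<Suc n. 2 ^ k) * (log 2 (real n) + 3 * ?w)"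
      by (rule sum_distrib_right[symmetric])
    also have "\<dots> \<le> 2 ^ Suc n * (log 2 (real n) + 3 * ?w)"
      using assms max_cost_nonneg[of n] by (intro mult_right_mono power2_sum_le) auto
    finally show "(\<Sum>k<Suc n. 2 ^ k * (log 2 (real n) + 3 * ?w)) \<le> 2 * 2 ^ n * (log 2 (real n) + 3 * ?w)" by simp
    have "real (Suc n - 2) * (real n * ?w * ?P) \<le> real n * (real n * ?w * ?P)"
      using max_cost_nonneg[of n] by (intro mult_right_mono) auto
    then show "(\<Sum>k=2..n. real n * ?w * ?P) \<le> real n * (real n * ?w * ?P)" by simp
  qed
  finally show ?thesis by simp
qed

text \<open>A prefix ending in block \<open>n\<close> is charged up to the end of that block: order
  \<open>2 ^ n * log n\<close> bits against \<open>start n\<close>, which has order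
  \<open>n * 2 ^ n\<close>.\<close>

lemma limsup_ppm_len: "limsup (\<lambda>m. ereal (real (ppm_len (prefix_of seq m)) / real m)) = 0"
proof -
  define K where "K = (\<Sum>t<start 2. cost t)"
  define P where "P n = 2 * 2 ^ n * (log 2 (real n) + 3 * max_cost n) +
     real n * (real n * max_cost n * ((real n + 1) ^ 2 * (2 * real n) + 3 * real n))" for n
  have "0 \<le> K" unfolding K_def by (intro sum_nonneg cost_nonneg)
  have Pnonneg: "0 \<le> P n" if "2 \<le> n" for n
    using that max_cost_nonneg[of n] unfolding P_def by (intro add_nonneg_nonneg mult_nonneg_nonneg) auto
  \<comment> \<open>The absolute value keeps \<open>G n\<close> above \<open>K\<close> for
    \<open>n < 2\<close>, where \<open>Pnonneg\<close> gives nothing.\<close>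
  define G where "G n = K + \<bar>P n\<bar> + 1" for n
  have "(\<lambda>m. real (ppm_len (prefix_of seq m)) / real m) \<longlonglongrightarrow> 0"
  proof (rule average_tendsto_zero[where G = G])
    fix n m assume m: "start n \<le> m" "m < start (Suc n)"
    have "real (ppm_len (prefix_of seq m)) \<le> (\<Sum>t<m. cost t) + 1" by (rule ppm_len_le)
    also have "(\<Sum>t<m. cost t) \<le> (\<Sum>t<start (Suc n). cost t)"
      using m by (intro sum_mono2) (auto simp: cost_nonneg)
    also have "(\<Sum>t<start (Suc n). cost t) \<le> K + \<bar>P n\<bar>"
    proof (cases "2 \<le> n")
      case True
      then show ?thesis using cost_start[OF True] Pnonneg[OF True] unfolding K_def P_def by simp
    next
      case False
      then have "start (Suc n) \<le> start 2" by (intro mono_start) simp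
      then have "(\<Sum>t<start (Suc n). cost t) \<le> K"
        unfolding K_def by (intro sum_mono2) (auto simp: cost_nonneg simp del: start_Suc)
      then show ?thesis by linarith
    qed
    finally show "real (ppm_len (prefix_of seq m)) \<le> G n" unfolding G_def by simp
  next
    have "(\<lambda>n. P n / ((real n - 2) * 2 ^ n + 2)) \<longlonglongrightarrow> 0"
      unfolding P_def max_cost_def by real_asymp
    then have "(\<lambda>n. \<bar>P n / ((real n - 2) * 2 ^ n + 2)\<bar>) \<longlonglongrightarrow> 0" by (rule tendsto_rabs_zero)
    moreover have "(\<lambda>n. (K + 1) / ((real n - 2) * 2 ^ n + 2)) \<longlonglongrightarrow> 0" by real_asymp
    ultimately have "(\<lambda>n. (K + 1) / ((real n - 2) * 2 ^ n + 2) + \<bar>P n / ((real n - 2) * 2 ^ n + 2)\<bar>) \<longlonglongrightarrow> 0 + 0"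
      by (intro tendsto_add)
    then show "(\<lambda>n. G n / real (start n)) \<longlonglongrightarrow> 0"
      unfolding real_start[symmetric] by (simp add: G_def add_divide_distrib ac_simps)
  qed simp
  then have "limsup (\<lambda>m. ereal (real (ppm_len (prefix_of seq m)) / real m)) = ereal 0"
    by (intro lim_imp_Limsup tendsto_ereal) simp_all
  then show ?thesis by (simp add: zero_ereal_def)
qed

theorem theorem4:
  shows "\<exists>S. normal S
    \<and> limsup (\<lambda>m. ereal (real (ppm_len (prefix_of S m)) / real m)) = 0
    \<and> liminf (\<lambda>m. ereal (real (length (LZ (prefix_of S m))) / real m)) = 1"
  using normal_seq limsup_ppm_len liminf_LZ by blast

end
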